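(* For bounded values of $\delta\in\mathbb R$ and $x\ge0$ there are coefficients $c_k=c_k(x,\delta)$, $k\ge1$, independent of $n$, such that $$F_n(x;\delta)\sim\tfrac12\operatorname{erfc}\left((\delta-x)/\sqrt2\right)+B(x;\delta)\sum_{k=1}^\infty\frac{c_k}{n^k},\qquad n\to\infty,$$ i.e. for every integer $N\ge1$, $F_n(x;\delta)=\tfrac12\operatorname{erfc}\left((\delta-x)/\sqrt2\right)+B(x;\delta)\left(\sum_{k=1}^{N}c_kn^{-k}+\mathcal O\left(n^{-N-1}\right)\right)$ as $n\to\infty$ for $x$ and $\delta$ in bounded sets, where $$B(x;\delta)=x\sqrt{\frac2\pi}\,e^{-\frac12(\delta-x)^2},$$ and the first coefficients are $$c_1=\tfrac18\left(x\delta-x^2-1\right),$$ $$c_2=\tfrac1{192}\left(3\delta^3x^3-9\delta^2x^4+9\delta x^5-3x^6-2\delta^2x^2-5\delta x^3+7x^4-3\delta x+5x^2+3\right).$$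
   Context: Notation. $\operatorname{erfc}(z)=\frac{2}{\sqrt\pi}\int_z^\infty e^{-t^2}dt$. $I_y(a,b)=\frac{1}{B(a,b)}\int_0^y t^{a-1}(1-t)^{b-1}dt$ is the normalized incomplete beta function, with $B(a,b)=\Gamma(a)\Gamma(b)/\Gamma(a+b)$ (not to be confused with $B(x;\delta)$). For $x\ge 0$, $\delta\in\mathbb R$, $n>0$ (not necessarily an integer), with $y=x^2/(n+x^2)$, the noncentral $t$-distribution is $$F_n(x;\delta)=\tfrac12\operatorname{erfc}\left(\delta/\sqrt2\right)+P_n(x;\delta)+Q_n(x;\delta),$$ $$P_n(x;\delta)=\tfrac12 e^{-\frac12\delta^2}\sum_{j=0}^\infty \frac{(\frac12\delta^2)^j}{j!}\, I_y\left(j+\tfrac12,\tfrac12 n\right),\qquad Q_n(x;\delta)=\tfrac12 e^{-\frac12\delta^2}\sum_{j=0}^\infty \frac{\delta}{\sqrt2}\frac{(\frac12\delta^2)^j}{\Gamma(j+\frac32)}\, I_y\left(j+1,\tfrac12 n\right).$$ *)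

theory Defs
  imports "HOL-Analysis.Analysis"
begin

definition erfc :: "real \<Rightarrow> real" where
  "erfc z = 2 / sqrt pi * integral {z..} (\<lambda>t. exp (- t\<^sup>2))"

definition inc_beta :: "real \<Rightarrow> real \<Rightarrow> real \<Rightarrow> real" where
  "inc_beta y a b =
     1 / Beta a b * integral {0..y} (\<lambda>t. t powr (a - 1) * (1 - t) powr (b - 1))"

definition nct_y :: "real \<Rightarrow> real \<Rightarrow> real" where
  "nct_y n x = x\<^sup>2 / (n + x\<^sup>2)"

definition nct_P :: "real \<Rightarrow> real \<Rightarrow> real \<Rightarrow> real" where
  "nct_P n x \<delta> = 1/2 * exp (- \<delta>\<^sup>2 / 2) *
     (\<Sum>j. (\<delta>\<^sup>2 / 2) ^ j / fact j * inc_beta (nct_y n x) (real j + 1/2) (n / 2))"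

definition nct_Q :: "real \<Rightarrow> real \<Rightarrow> real \<Rightarrow> real" where
  "nct_Q n x \<delta> = 1/2 * exp (- \<delta>\<^sup>2 / 2) *
     (\<Sum>j. \<delta> / sqrt 2 * ((\<delta>\<^sup>2 / 2) ^ j / Gamma (real j + 3/2))
            * inc_beta (nct_y n x) (real j + 1) (n / 2))"

(* Noncentral t-distribution F_n(x; delta); only meaningful for n > 0 and x >= 0. *)
definition nct_F :: "real \<Rightarrow> real \<Rightarrow> real \<Rightarrow> real" where
  "nct_F n x \<delta> = 1/2 * erfc (\<delta> / sqrt 2) + nct_P n x \<delta> + nct_Q n x \<delta>"

definition nct_B :: "real \<Rightarrow> real \<Rightarrow> real" where
  "nct_B x \<delta> = x * sqrt (2 / pi) * exp (- (\<delta> - x)\<^sup>2 / 2)"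

end

theory Submission
  imports Defs "HOL-Computational_Algebra.Polynomial"
begin

text \<open>
  The noncentral t-distribution is a mixture of normal distributions: with \<open>W\<close> Gamma distributed with shape
  \<open>n / 2\<close> and mean 1, \<open>F_n(x; \<delta>)\<close> is the expectation of \<open>G(W) = erfc ((\<delta> - x sqrt W) / sqrt 2) / 2\<close>. Expanding
  the Gaussian density in powers of \<open>\<delta>\<close> and integrating term by term identifies this with the series of incomplete
  beta functions. The central moments of \<open>W\<close> of order \<open>m\<close> are polynomials in \<open>1 / n\<close> divisible by
  \<open>n ^ (-\<lceil>m / 2\<rceil>)\<close>, so Taylor expansion of \<open>G\<close> at 1 to order \<open>2 N + 1\<close> gives the asymptotic expansion. All
  derivatives of \<open>G\<close> carry a factor \<open>x\<close>, whence the factor \<open>B(x; \<delta>)\<close> in the error term.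
\<close>

section \<open>The mixing law\<close>

text \<open>A noncentral t variable is (Z + \<delta>) / sqrt W with Z standard normal, W independent
  of Z and n W chi-square with n degrees of freedom; given W = w it is at most x with probability
  \<open>mixed_cdf x \<delta> w\<close>. Hence the mean 1, and all dependence on n sits in the law
  of W. The Taylor order 2 N + 1 suits two needs: moments up to order 2 N can contribute to n^(-N),
  and the next power of w - 1 has even order 2 N + 2, so it is nonnegative and its mean is itself a
  central moment, already of size n^(-N-1). The obstacle is uniformity. The error must be a multiple
  of B(x; \<delta>), which vanishes at x = 0, so every remainder bound has to keep a factor x,
  although the derivatives of G are not bounded as w tends to 0.\<close>

definition gamma_density :: "real \<Rightarrow> real \<Rightarrow> real" where
  "gamma_density a w =
     indicator {0<..} w * (a powr a / Gamma a * w powr (a - 1) * exp (- a * w))"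

lemma gamma_density_nonneg: "a > 0 \<Longrightarrow> gamma_density a w \<ge> 0"
  by (auto simp: gamma_density_def indicator_def Gamma_real_pos less_imp_le)

lemma gamma_density_eq_0: "w \<le> 0 \<Longrightarrow> gamma_density a w = 0"
  by (simp add: gamma_density_def)

lemma borel_measurable_gamma_density [measurable]: "gamma_density a \<in> borel_measurable borel"
  unfolding gamma_density_def by measurable

lemma has_bochner_integral_gamma_kernel:
  fixes s c :: real
  assumes s: "s > 0" and c: "c > 0"
  shows "has_bochner_integral lborel
           (\<lambda>w. indicator {0<..} w * (w powr (s - 1) * exp (- c * w))) (Gamma s / c powr s)"
proof -
  let ?f = "\<lambda>t::real. indicator {0..} t * t powr (s - 1) / exp t"
  have "has_bochner_integral lborel ?f (Gamma s)"
    using Gamma_conv_nn_integral_real[OF s] s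
    by (intro has_bochner_integral_nn_integral) (auto simp: Gamma_real_pos less_imp_le)
  then have "has_bochner_integral lborel (\<lambda>w. ?f (0 + c * w)) (Gamma s /\<^sub>R \<bar>c\<bar>)"
    using c by (subst (asm) lborel_has_bochner_integral_real_affine_iff[where c = c and t = 0]) auto
  \<comment> \<open>The factor cancels the c powr (s - 1) that (c w) powr (s - 1) brings in.\<close>
  then have "has_bochner_integral lborel (\<lambda>w. ?f (0 + c * w) * c powr (1 - s))
               ((Gamma s /\<^sub>R \<bar>c\<bar>) * c powr (1 - s))"
    by (rule has_bochner_integral_mult_left[rotated])
  also have "(\<lambda>w. ?f (0 + c * w) * c powr (1 - s)) =
             (\<lambda>w. indicator {0<..} w * (w powr (s - 1) * exp (- c * w)))"
  proof
    fix w :: real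
    show "?f (0 + c * w) * c powr (1 - s) = indicator {0<..} w * (w powr (s - 1) * exp (- c * w))"
    proof (cases "w > 0")
      case True
      have "c powr (s - 1) * c powr (1 - s) = 1"
        using c by (simp flip: powr_add)
      with True c show ?thesis
        by (simp add: powr_mult exp_minus field_simps)
    next
      \<comment> \<open>At w = 0 the two indicators differ, but \<open>0 powr (s - 1)\<close> is
        0.\<close>
      case False
      then show ?thesis
        using c by (cases "w = 0") (auto simp: indicator_def zero_le_mult_iff)
    qed
  qed
  also have "(Gamma s /\<^sub>R \<bar>c\<bar>) * c powr (1 - s) = Gamma s / c powr s"
    using c by (simp add: powr_diff field_simps)
  finally show ?thesis .
qed

text \<open>The weight keeps the integrand in the Gamma family: the shape becomes a + p and the rate
  a + q. The moments use q = 0, the joint density uses q = u^2 / 2.\<close>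

lemma has_bochner_integral_gamma_density:
  fixes a p q :: real
  assumes a: "a > 0" and p: "a + p > 0" and q: "a + q > 0"
  shows "has_bochner_integral lborel (\<lambda>w. gamma_density a w * (w powr p * exp (- q * w)))
           (a powr a / Gamma a * (Gamma (a + p) / (a + q) powr (a + p)))"
proof -
  have "(\<lambda>w. gamma_density a w * (w powr p * exp (- q * w))) =
        (\<lambda>w. a powr a / Gamma a *
           (indicator {0<..} w * (w powr (a + p - 1) * exp (- (a + q) * w))))"
  proof
    fix w :: real
    have "w powr (a + p - 1) = w powr (a - 1) * w powr p"
      by (simp add: algebra_simps flip: powr_add)
    moreover have "exp (- (a + q) * w) = exp (- a * w) * exp (- q * w)"
      by (simp add: algebra_simps flip: exp_add)
    ultimately show "gamma_density a w * (w powr p * exp (- q * w)) = a powr a / Gamma a *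
           (indicator {0<..} w * (w powr (a + p - 1) * exp (- (a + q) * w)))"
      by (simp only: gamma_density_def mult_ac)
  qed
  then show ?thesis
    using has_bochner_integral_mult_right[OF has_bochner_integral_gamma_kernel[OF p q]]
    by (simp only:)
qed

lemma has_bochner_integral_gamma_moment:
  assumes a: "a > 0"
  shows "has_bochner_integral lborel (\<lambda>w. gamma_density a w * w ^ m) (pochhammer a m / a ^ m)"
proof -
  have "has_bochner_integral lborel (\<lambda>w. gamma_density a w * (w powr m * exp (- 0 * w)))
          (a powr a / Gamma a * (Gamma (a + m) / (a + 0) powr (a + m)))"
    using a by (intro has_bochner_integral_gamma_density) auto
  also have "(\<lambda>w. gamma_density a w * (w powr m * exp (- 0 * w))) = (\<lambda>w. gamma_density a w * w ^ m)"
  proof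
    fix w :: real
    show "gamma_density a w * (w powr m * exp (- 0 * w)) = gamma_density a w * w ^ m"
      by (cases "w > 0") (auto simp: powr_realpow gamma_density_eq_0)
  qed
  also have "a powr a / Gamma a * (Gamma (a + m) / (a + 0) powr (a + m)) = pochhammer a m / a ^ m"
  proof -
    have "a \<notin> \<int>\<^sub>\<le>\<^sub>0"
      using a by (auto elim!: nonpos_Ints_cases)
    then show ?thesis
      using a by (simp add: pochhammer_Gamma powr_add powr_realpow)
  qed
  finally show ?thesis .
qed

section \<open>Stein's identity and the central moments of the mixing law\<close>

lemma integrable_gamma_density_poly:
  assumes a: "a > 0"
  shows "integrable lborel (\<lambda>w. gamma_density a w * poly p w)"
proof -
  have "(\<lambda>w. gamma_density a w * poly p w) =
          (\<lambda>w. \<Sum>i\<le>degree p. coeff p i * (gamma_density a w * w ^ i))"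
    by (simp add: poly_altdef sum_distrib_left mult_ac)
  moreover have "integrable lborel (\<lambda>w. gamma_density a w * w ^ i)" for i
    using has_bochner_integral_gamma_moment[OF a] by (rule integrable.intros)
  ultimately show ?thesis by simp
qed

text \<open>The density \<rho> satisfies (w \<rho>)' = a (1 - w) \<rho>, so this is integration by
  parts. Boundary terms are avoided by checking monomials, where it reduces to (a)_(m+1) = (a)_m (a
  + m) for the rising factorial, and extending linearly.\<close>

lemma gamma_density_stein:
  assumes a: "a > 0"
  shows "(\<integral>w. gamma_density a w * poly ([:-1, 1:] * p) w \<partial>lborel) =
         (\<integral>w. gamma_density a w * poly ([:0, 1:] * pderiv p) w \<partial>lborel) / a"
proof -
  define E where "E p = (\<integral>w. gamma_density a w * poly p w \<partial>lborel)" for p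
  have E_add: "E (p + q) = E p + E q" for p q
    unfolding E_def poly_add distrib_left
    by (intro Bochner_Integration.integral_add integrable_gamma_density_poly a)
  have E_smult: "E (smult c p) = c * E p" for c p
    unfolding E_def poly_smult mult.left_commute[of _ c] by simp
  have E_monom: "E (monom 1 m) = pochhammer a m / a ^ m" for m
    unfolding E_def poly_monom
    using has_bochner_integral_integral_eq[OF has_bochner_integral_gamma_moment[OF a]] by simp
  have E_0: "E 0 = 0"
    by (simp add: E_def)
  have monom_case: "E ([:-1, 1:] * monom 1 m) = E ([:0, 1:] * pderiv (monom 1 m)) / a" for m
  proof -
    have "[:-1, 1:] * monom 1 m = monom 1 (Suc m) + smult (- 1) (monom (1::real) m)"
      by (simp add: monom_Suc)
    moreover have "[:0, 1:] * pderiv (monom 1 m) = smult (real m) (monom 1 m)"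
      by (cases m) (simp_all add: pderiv_monom monom_Suc smult_monom flip: monom_Suc)
    ultimately show ?thesis
      using a by (simp only: E_add E_smult E_monom) (simp add: pochhammer_Suc field_simps)
  qed
  have "E ([:-1, 1:] * (\<Sum>i\<in>A. monom (coeff p i) i)) =
          E ([:0, 1:] * pderiv (\<Sum>i\<in>A. monom (coeff p i) i)) / a" if "finite A" for A
    using that
  proof induction
    case (insert i A)
    let ?s = "\<Sum>i\<in>A. monom (coeff p i) i"
    have "(\<Sum>i\<in>insert i A. monom (coeff p i) i) = smult (coeff p i) (monom 1 i) + ?s"
      using insert by (simp add: smult_monom)
    moreover have "E ([:-1, 1:] * (smult c q + ?s)) = E ([:0, 1:] * pderiv (smult c q + ?s)) / a"
      if "E ([:-1, 1:] * q) = E ([:0, 1:] * pderiv q) / a" for c q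
      unfolding pderiv_add pderiv_smult distrib_left mult_smult_right E_add E_smult that insert.IH
      by (simp add: add_divide_distrib)
    ultimately show ?case
      using monom_case by presburger
  qed (simp add: E_0)
  from this[of "{..degree p}"] show ?thesis
    by (simp add: poly_as_sum_of_monoms E_def del: mult_pCons_left)
qed

text \<open>The central moments of the Gamma law with shape \<open>n / 2\<close> and mean 1, as polynomials in \<open>1 / n\<close>;
  the recursion is Stein's identity applied to powers of \<open>w - 1\<close>.\<close>

fun central_moment_poly :: "nat \<Rightarrow> real poly" where
  "central_moment_poly 0 = 1"
| "central_moment_poly (Suc 0) = 0"
| "central_moment_poly (Suc (Suc k)) =
     [:0, 2 * real (Suc k):] * (central_moment_poly (Suc k) + central_moment_poly k)"

lemma central_moment_eq:
  assumes n: "n > 0"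
  shows "(\<integral>w. gamma_density (n / 2) w * (w - 1) ^ k \<partial>lborel) = poly (central_moment_poly k) (1 / n)"
proof (induction k rule: central_moment_poly.induct)
  case 1
  show ?case
    using has_bochner_integral_integral_eq[OF has_bochner_integral_gamma_moment[of "n / 2" 0]] n
    by simp
next
  case 2
  show ?case
    using gamma_density_stein[of "n / 2" 1] n by (simp add: algebra_simps)
next
  case (3 k)
  let ?q = "[:-1, 1:] :: real poly"
  have int: "integrable lborel (\<lambda>w. gamma_density (n / 2) w * (w - 1) ^ j)" for j
    using integrable_gamma_density_poly[of "n / 2" "?q ^ j"] n by (simp add: algebra_simps)
  have "(\<integral>w. gamma_density (n / 2) w * (w - 1) ^ Suc (Suc k) \<partial>lborel) =
        (\<integral>w. gamma_density (n / 2) w * poly (?q * ?q ^ Suc k) w \<partial>lborel)"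
    by (simp add: algebra_simps)
  also have "\<dots> = (\<integral>w. gamma_density (n / 2) w * poly ([:0, 1:] * pderiv (?q ^ Suc k)) w \<partial>lborel) / (n / 2)"
    using n by (intro gamma_density_stein) auto
  \<comment> \<open>Writing w = (w - 1) + 1 turns w (w - 1)^k into two central powers; the divisor a
    = n / 2 yields the factor 2 (k + 1) / n of the recursion.\<close>
  also have "\<dots> = (\<integral>w. real (Suc k) * (gamma_density (n / 2) w * (w - 1) ^ Suc k
                        + gamma_density (n / 2) w * (w - 1) ^ k) \<partial>lborel) / (n / 2)"
    by (intro arg_cong2[where f = "(/)"] Bochner_Integration.integral_cong refl)
       (simp only: pderiv_power_Suc, simp add: pderiv_pCons algebra_simps)
  also have "\<dots> = poly (central_moment_poly (Suc (Suc k))) (1 / n)"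
    unfolding integral_mult_right_zero
    using 3 by (subst Bochner_Integration.integral_add[OF int int]) (simp add: field_simps)
  finally show ?case .
qed

text \<open>Each use of the recursion contributes one factor 1 / n and lowers the order by at most
  two, so at least k / 2 such factors accumulate.\<close>

lemma coeff_central_moment_poly_eq_0: "2 * j < k \<Longrightarrow> coeff (central_moment_poly k) j = 0"
proof (induction k arbitrary: j rule: central_moment_poly.induct)
  case (3 k)
  then show ?case by (cases j) (auto simp: coeff_pCons)
qed auto

section \<open>Normal mixture representation\<close>

lemma gauss_integrable_on_atLeast: "(\<lambda>t::real. exp (- t\<^sup>2)) integrable_on {z..}"
proof -
  have 1: "(\<lambda>t. exp 1 * exp (- 2 * t)) integrable_on {z..}"
    by (intro integrable_on_mult_right integrable_on_exp_minus_to_infinity) simp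
  have 2: "(\<lambda>t::real. exp (- t\<^sup>2)) \<in> borel_measurable (lebesgue_on {z..})"
    by (intro continuous_imp_measurable_on_sets_lebesgue continuous_intros) auto
  \<comment> \<open>This is (t - 1)^2 \<ge> 0; the majorant is integrable on every half-line
    \<open>{z..}\<close>, whatever the sign of z.\<close>
  have 3: "\<bar>exp (- t\<^sup>2)\<bar> \<le> exp 1 * exp (- 2 * t)" for t :: real
  proof -
    have "- t\<^sup>2 \<le> 1 + - 2 * t"
      using zero_le_power2[of "t - 1"] by (simp add: power2_eq_square algebra_simps)
    then show ?thesis by (simp flip: exp_add)
  qed
  show ?thesis
    by (rule measurable_bounded_by_integrable_imp_integrable_real[OF 2 1]) (use 3 in \<open>simp_all only: sets_completionI_sets sets_lborel\<close>, auto)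
qed

text \<open>Splitting the tail integral at z - 1 leaves a constant minus a proper integral with
  moving upper endpoint. The split point lies to the left of z so that z is interior and the
  derivative is two-sided.\<close>

lemma has_real_derivative_erfc [derivative_intros]:
  assumes "(f has_real_derivative f') (at x within S)"
  shows "((\<lambda>x. erfc (f x)) has_real_derivative - 2 / sqrt pi * exp (- (f x)\<^sup>2) * f') (at x within S)"
proof -
  have *: "(erfc has_real_derivative - 2 / sqrt pi * exp (- z\<^sup>2)) (at z)" for z
  proof -
    let ?g = "\<lambda>t::real. exp (- t\<^sup>2)"
    have split: "erfc u = erfc (z - 1) - 2 / sqrt pi * integral {z - 1..u} ?g" if "u \<ge> z - 1" for u
    proof -
      have "integral ({z - 1..u} \<union> {u..}) ?g = integral {z - 1..u} ?g + integral {u..} ?g"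
        by (intro integral_Un gauss_integrable_on_atLeast integrable_continuous_interval
              continuous_intros) (use that in \<open>auto intro: negligible_subset[of "{u}"]\<close>)
      moreover have "{z - 1..u} \<union> {u..} = {z - 1..}"
        using that by auto
      ultimately show ?thesis
        by (simp add: erfc_def algebra_simps)
    qed
    have "((\<lambda>u. integral {z - 1..u} ?g) has_real_derivative ?g z) (at z within {z - 1..z + 1})"
      by (intro integral_has_real_derivative continuous_intros) auto
    then have "((\<lambda>u. integral {z - 1..u} ?g) has_real_derivative ?g z) (at z)"
      by (simp add: at_within_Icc_at)
    then have "((\<lambda>u. erfc (z - 1) - 2 / sqrt pi * integral {z - 1..u} ?g)
                  has_real_derivative - 2 / sqrt pi * exp (- z\<^sup>2)) (at z)"
      by (auto intro!: derivative_eq_intros simp: real_div_sqrt field_simps)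
    then show ?thesis
      by (rule has_field_derivative_transform_within_open[where S = "{z - 1<..}"])
         (auto intro!: split[symmetric] simp del: times_divide_eq_left)
  qed
  show ?thesis
    using DERIV_chain2[OF * assms] .
qed

text \<open>Completing the square, \<delta> s - s^2 / 2 = \<delta>^2 / 2 - (\<delta> - s)^2 / 2 with
  s = u v, makes a rescaled erfc a primitive. With v = \<open>sqrt w\<close> this carries out the
  u-integration of the joint density.\<close>

lemma gauss_interval_has_integral:
  fixes v x \<delta> :: real
  assumes "x \<ge> 0"
  shows "((\<lambda>u. v * exp (\<delta> * (u * v) - (u * v)\<^sup>2 / 2)) has_integral
           sqrt (2 * pi) * exp (\<delta>\<^sup>2 / 2) * (erfc ((\<delta> - x * v) / sqrt 2) / 2 - erfc (\<delta> / sqrt 2) / 2)) {0..x}"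
proof -
  let ?c = "sqrt (2 * pi) * exp (\<delta>\<^sup>2 / 2)"
  let ?G = "\<lambda>u. ?c * (erfc ((\<delta> - u * v) / sqrt 2) / 2)"
  have "((\<lambda>u. v * exp (\<delta> * (u * v) - (u * v)\<^sup>2 / 2)) has_integral (?G x - ?G 0)) {0..x}"
  proof (rule fundamental_theorem_of_calculus)
    fix u assume "u \<in> {0..x}"
    have e: "exp (\<delta>\<^sup>2 / 2) * exp (- ((\<delta> - u * v) / sqrt 2)\<^sup>2) = exp (\<delta> * (u * v) - (u * v)\<^sup>2 / 2)"
      by (simp flip: exp_add) (simp add: power_divide power2_eq_square field_simps)
    have "(?G has_real_derivative ?c * (- 2 / sqrt pi * exp (- ((\<delta> - u * v) / sqrt 2)\<^sup>2) * (- v / sqrt 2) / 2))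
            (at u within {0..x})"
      by (rule DERIV_cmult DERIV_cdivide has_real_derivative_erfc)+ (auto intro!: derivative_eq_intros)
    moreover have "?c * (- 2 / sqrt pi * exp (- ((\<delta> - u * v) / sqrt 2)\<^sup>2) * (- v / sqrt 2) / 2) =
        v * exp (\<delta> * (u * v) - (u * v)\<^sup>2 / 2)"
      unfolding e[symmetric] real_sqrt_mult by (simp add: field_simps)
    ultimately show "(?G has_vector_derivative v * exp (\<delta> * (u * v) - (u * v)\<^sup>2 / 2)) (at u within {0..x})"
      by (simp add: has_real_derivative_iff_has_vector_derivative)
  qed (use assms in auto)
  then show ?thesis by (simp add: algebra_simps)
qed

text \<open>The substitution is t = u^2 / (n + u^2), 1 - t = n / (n + u^2). Up to a constant, the
  integrand on the left is what remains of the joint density once w has been integrated out.\<close>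

lemma inc_beta_substitution:
  fixes n x :: real and k :: nat
  assumes n: "n > 0" and x: "x \<ge> 0"
  defines "p \<equiv> (real k + 1) / 2"
  shows "(\<integral>u. indicator {0..x} u * (u ^ k * (n + u\<^sup>2) powr - (n / 2 + p)) \<partial>lborel) =
           Beta p (n / 2) * inc_beta (nct_y n x) p (n / 2) / (2 * n powr (n / 2))"
proof -
  define a where "a = n / 2"
  define R where "R = (\<integral>u. indicator {0..x} u * (u ^ k * (n + u\<^sup>2) powr - (a + p)) \<partial>lborel)"
  define f where "f t = t powr (p - 1) * (1 - t) powr (a - 1)" for t :: real
  define g where "g u = u\<^sup>2 / (n + u\<^sup>2)" for u :: real
  define g' where "g' u = 2 * u * n / (n + u\<^sup>2)\<^sup>2" for u :: real
  have pos: "n + u\<^sup>2 > 0" for u :: real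
    using n by (simp add: add_pos_nonneg)
  have ab: "a > 0" "p > 0"
    using n by (auto simp: a_def p_def)
  have int: "integrable lborel (\<lambda>u. indicator {0..x} u * (u ^ k * (n + u\<^sup>2) powr - (a + p)))"
    using borel_integrable_compact[of "{0..x}" "\<lambda>u. u ^ k * (n + u\<^sup>2) powr - (a + p)"] pos
    by (simp add: less_imp_neq[THEN not_sym] continuous_intros indicator_def if_distrib cong: if_cong)
  have R0: "R \<ge> 0"
    unfolding R_def by (intro Bochner_Integration.integral_nonneg) (auto simp: indicator_def)
  have g0: "g 0 = 0" and gx: "g x = nct_y n x"
    by (simp_all add: g_def nct_y_def)
  have "(\<integral>\<^sup>+t. f t * indicator {g 0..g x} t \<partial>lborel) = (\<integral>\<^sup>+u. f (g u) * g' u * indicator {0..x} u \<partial>lborel)"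
  \<comment> \<open>Nonnegative integrals need no separate treatment of k = 0, where p = 1/2 and t
    powr (p - 1) is unbounded near 0.\<close>
  proof (rule nn_integral_substitution)
    show "set_borel_measurable borel {g 0..g x} f"
      unfolding set_borel_measurable_def f_def by measurable
    show "(g has_real_derivative g' u) (at u)" for u
      unfolding g_def g'_def using pos[of u]
      by (auto intro!: derivative_eq_intros simp: power2_eq_square) (simp add: field_simps)
    show "continuous_on {0..x} g'"
      unfolding g'_def using pos by (intro continuous_intros) (auto simp: less_imp_neq[THEN not_sym])
    show "g' u \<ge> 0" if "u \<in> {0..x}" for u
      using that n by (auto simp: g'_def)
  qed (use x in auto)
  also have "\<dots> = (\<integral>\<^sup>+u. ennreal (2 * n powr a * (indicator {0..x} u * (u ^ k * (n + u\<^sup>2) powr - (a + p)))) \<partial>lborel)"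
  \<comment> \<open>The point u = 0 has to be left out: for k = 0 the left side is 0 there, while
    the right side is positive.\<close>
  proof (intro nn_integral_cong_AE eventually_mono[OF AE_lborel_singleton[of 0]])
    fix u :: real assume u0: "u \<noteq> 0"
    show "ennreal (f (g u) * g' u * indicator {0..x} u) =
          ennreal (2 * n powr a * (indicator {0..x} u * (u ^ k * (n + u\<^sup>2) powr - (a + p))))"
    proof (cases "u \<in> {0..x}")
      case True
      with u0 have u: "u > 0" by auto
      define m where "m = n + u\<^sup>2"
      have m: "m > 0" using pos[of u] by (simp add: m_def)
      have 1: "1 - g u = n / m"
        using m by (simp add: g_def m_def field_simps)
      have 2: "g u = u\<^sup>2 / m"
        by (simp add: g_def m_def)
      have 3: "u\<^sup>2 powr (p - 1) * u = u ^ k"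
      proof -
        have "u\<^sup>2 powr (p - 1) * u = (u powr 2) powr (p - 1) * u powr 1"
          using u by (simp add: powr_numeral)
        also have "\<dots> = u powr (2 * (p - 1) + 1)"
          unfolding powr_powr powr_add ..
        also have "2 * (p - 1) + 1 = real k"
          by (simp add: p_def field_simps)
        finally show ?thesis using u by (simp add: powr_realpow)
      qed
      have 4: "n powr (a - 1) * n = n powr a"
        using n by (simp add: powr_diff)
      have 5: "m powr - (a + p) = 1 / (m powr (p - 1) * m powr (a - 1) * m\<^sup>2)"
      proof -
        have "m powr (p - 1) * m powr (a - 1) * m powr 2 = m powr (a + p)"
          unfolding powr_add[symmetric] by (simp add: algebra_simps)
        then have "m powr (p - 1) * m powr (a - 1) * m\<^sup>2 = m powr (a + p)"
          using m by (simp add: powr_numeral)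
        then show ?thesis unfolding powr_minus_divide by simp
      qed
      have "f (g u) * g' u = 2 * (n powr (a - 1) * n) * (u\<^sup>2 powr (p - 1) * u) / (m powr (p - 1) * m powr (a - 1) * m\<^sup>2)"
        using m n u unfolding f_def 1 unfolding 2 g'_def m_def[symmetric]
        by (simp add: powr_divide field_simps)
      then show ?thesis
        using True unfolding 3 4 m_def[symmetric] 5 by simp
    qed simp
  qed
  also have "\<dots> = ennreal (2 * n powr a * R)"
    unfolding R_def
    by (subst nn_integral_eq_integral) (use int in \<open>auto simp: indicator_def\<close>)
  finally have "(\<integral>\<^sup>+t. f t * indicator {g 0..g x} t \<partial>lborel) = ennreal (2 * n powr a * R)" .
  moreover have "(\<lambda>t. f t * indicator {g 0..g x} t) \<in> borel_measurable borel"
    unfolding f_def by measurable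
  ultimately have "((\<lambda>t. f t * indicator {g 0..g x} t) has_integral (2 * n powr a * R)) UNIV"
    using R0 by (intro nn_integral_has_integral) (auto simp: f_def)
  also have "(\<lambda>t. f t * indicator {g 0..g x} t) = (\<lambda>t. if t \<in> {0..nct_y n x} then f t else 0)"
    by (auto simp: fun_eq_iff g0 gx)
  finally have "(f has_integral (2 * n powr a * R)) {0..nct_y n x}"
    unfolding has_integral_restrict_UNIV .
  then have "integral {0..nct_y n x} f = 2 * n powr a * R"
    by (rule integral_unique)
  moreover have "Beta p a \<noteq> 0"
    using ab by (simp add: Beta_def Gamma_eq_zero_iff) (auto elim!: nonpos_Ints_cases)
  moreover have "n powr a \<noteq> 0" using n by simp
  ultimately show ?thesis
    unfolding inc_beta_def R_def f_def a_def by (simp add: field_simps)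
qed

text \<open>The terms \<open>k = 2 j\<close> are those of \<open>nct_P\<close>, the terms \<open>k = 2 j + 1\<close> those of \<open>nct_Q\<close>.\<close>

definition nct_term :: "real \<Rightarrow> real \<Rightarrow> real \<Rightarrow> nat \<Rightarrow> real" where
  "nct_term n x \<delta> k = (\<delta> / sqrt 2) ^ k / Gamma (real k / 2 + 1) * inc_beta (nct_y n x) ((real k + 1) / 2) (n / 2)"

text \<open>The Taylor terms in \<open>\<delta>\<close> of the joint density of the mixing variable \<open>w\<close> and of \<open>u \<le> x\<close>: integrating
  first over \<open>w\<close> gives incomplete beta functions, integrating the full series first over \<open>u\<close> gives erfc.\<close>

definition nct_integrand :: "real \<Rightarrow> real \<Rightarrow> real \<Rightarrow> nat \<Rightarrow> real \<times> real \<Rightarrow> real" where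
  "nct_integrand n x \<delta> k = (\<lambda>(w, u). gamma_density (n / 2) w * indicator {0..x} u *
     ((\<delta> * u) ^ k / fact k * w powr ((real k + 1) / 2) * exp (- (u\<^sup>2 / 2) * w)))"

definition nct_dominant :: "real \<Rightarrow> real \<Rightarrow> real \<times> real \<Rightarrow> real" where
  "nct_dominant n x = (\<lambda>(w, u). gamma_density (n / 2) w * indicator {0..x} u * sqrt w)"

section \<open>Termwise integration of the joint density\<close>

lemma powr_half_Suc: "w > 0 \<Longrightarrow> w powr ((real k + 1) / 2) = sqrt w * sqrt w ^ k"
  by (simp add: add_divide_distrib powr_add powr_half_sqrt powr_half_sqrt_powr powr_realpow
        real_sqrt_power)

text \<open>Legendre's duplication formula at (k + 1) / 2. Passing from k to k + 1 swaps the two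
  factors and shifts one of them by 1, so the functional equation suffices. It trades the k! of the
  exponential series for the Gamma values in \<open>nct_term\<close>.\<close>

lemma Gamma_half_mult_Gamma_half_Suc:
  "Gamma ((real k + 1) / 2) * Gamma (real k / 2 + 1) = sqrt pi / 2 ^ k * fact k"
proof (induction k)
  case (Suc k)
  have "(real k + 1) / 2 \<notin> \<int>\<^sub>\<le>\<^sub>0"
    by (auto elim!: nonpos_Ints_cases simp: field_simps)
  then have "Gamma ((real k + 1) / 2 + 1) = (real k + 1) / 2 * Gamma ((real k + 1) / 2)"
    by (rule Gamma_plus1)
  moreover have "(real (Suc k) + 1) / 2 = real k / 2 + 1" "real (Suc k) / 2 + 1 = (real k + 1) / 2 + 1"
    by (simp_all add: field_simps)
  ultimately have "Gamma ((real (Suc k) + 1) / 2) * Gamma (real (Suc k) / 2 + 1) =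
      (real k + 1) / 2 * (Gamma ((real k + 1) / 2) * Gamma (real k / 2 + 1))"
    by (simp only: mult_ac)
  also note Suc.IH
  finally show ?case by (simp add: field_simps)
qed (simp add: Gamma_one_half_real)

lemma borel_measurable_nct_integrand [measurable]:
  "nct_integrand n x \<delta> k \<in> borel_measurable (lborel \<Otimes>\<^sub>M lborel)"
  unfolding nct_integrand_def by measurable

lemma integrable_nct_dominant:
  assumes n: "n > 0" and x: "x \<ge> 0"
  shows "integrable (lborel \<Otimes>\<^sub>M lborel) (nct_dominant n x)"
proof (rule lborel_pair.Fubini_integrable)
  have [measurable]: "nct_dominant n x \<in> borel_measurable (lborel \<Otimes>\<^sub>M lborel)"
    unfolding nct_dominant_def by measurable
  then show "nct_dominant n x \<in> borel_measurable (lborel \<Otimes>\<^sub>M lborel)" .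
  have norm: "norm (nct_dominant n x (w, u)) = gamma_density (n / 2) w * sqrt w * indicator {0..x} u" for w u
    using gamma_density_nonneg[of "n / 2" w] n
    by (cases "w > 0") (auto simp: nct_dominant_def gamma_density_eq_0 abs_mult)
  have "integrable lborel (\<lambda>w. gamma_density (n / 2) w * (w powr (1 / 2) * exp (- 0 * w)))"
    using n by (intro integrable.intros[OF has_bochner_integral_gamma_density]) auto
  also have "(\<lambda>w. gamma_density (n / 2) w * (w powr (1 / 2) * exp (- 0 * w))) =
             (\<lambda>w. gamma_density (n / 2) w * sqrt w)"
  proof
    fix w show "gamma_density (n / 2) w * (w powr (1 / 2) * exp (- 0 * w)) = gamma_density (n / 2) w * sqrt w"
      by (cases "w > 0") (auto simp: gamma_density_eq_0 powr_half_sqrt)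
  qed
  finally have "integrable lborel (\<lambda>w. gamma_density (n / 2) w * sqrt w * x)"
    by (rule integrable_mult_left)
  then show "integrable lborel (\<lambda>w. \<integral>u. norm (nct_dominant n x (w, u)) \<partial>lborel)"
    unfolding norm using x by simp
  show "AE w in lborel. integrable lborel (\<lambda>u. nct_dominant n x (w, u))"
  proof (intro AE_I2)
    fix w
    have "integrable lborel (\<lambda>u. gamma_density (n / 2) w * sqrt w * indicator {0..x} u)"
      by (intro integrable_mult_right integrable_real_indicator) (use x in auto)
    then show "integrable lborel (\<lambda>u. nct_dominant n x (w, u))"
      by (simp add: nct_dominant_def mult_ac)
  qed
qed

text \<open>With v = u sqrt w the absolute values sum to at most a multiple of exp (|\<delta>| v -
  v^2 / 2), and (|\<delta>| - v)^2 \<ge> 0 bounds the exponent by \<delta>^2 / 2. The Gaussian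
  factor thus absorbs the exponential series, uniformly in K.\<close>

lemma sum_abs_nct_integrand_le:
  assumes n: "n > 0" and x: "x \<ge> 0"
  shows "(\<Sum>k<K. \<bar>nct_integrand n x \<delta> k z\<bar>) \<le> exp (\<delta>\<^sup>2 / 2) * nct_dominant n x z"
proof -
  obtain w u where z: "z = (w, u)" by (cases z)
  show ?thesis
  proof (cases "w > 0 \<and> u \<in> {0..x}")
    case True
    define v where "v = u * sqrt w"
    define d where "d = gamma_density (n / 2) w"
    have d: "d \<ge> 0" using n by (simp add: d_def gamma_density_nonneg)
    have v: "v \<ge> 0" "v\<^sup>2 = u\<^sup>2 * w" using True by (auto simp: v_def power_mult_distrib)
    have "\<bar>nct_integrand n x \<delta> k z\<bar> = d * sqrt w * exp (- v\<^sup>2 / 2) * ((\<bar>\<delta>\<bar> * v) ^ k / fact k)" for k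
      using True d
      by (simp add: nct_integrand_def z powr_half_Suc abs_mult power_abs v(2))
         (simp add: d_def v_def power_mult_distrib abs_mult)
    then have "(\<Sum>k<K. \<bar>nct_integrand n x \<delta> k z\<bar>) = d * sqrt w * exp (- v\<^sup>2 / 2) * (\<Sum>k<K. (\<bar>\<delta>\<bar> * v) ^ k / fact k)"
      by (simp add: sum_distrib_left)
    also have "\<dots> \<le> d * sqrt w * exp (- v\<^sup>2 / 2) * exp (\<bar>\<delta>\<bar> * v)"
    proof (intro mult_left_mono)
      have "(\<lambda>k. (\<bar>\<delta>\<bar> * v) ^ k / fact k) sums exp (\<bar>\<delta>\<bar> * v)"
        using exp_converges[of "\<bar>\<delta>\<bar> * v"] by (simp add: field_simps)
      then show "(\<Sum>k<K. (\<bar>\<delta>\<bar> * v) ^ k / fact k) \<le> exp (\<bar>\<delta>\<bar> * v)"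
        using v by (subst sums_unique[of _ "exp (\<bar>\<delta>\<bar> * v)"]) (auto intro!: sum_le_suminf simp: sums_iff)
    qed (use d True in auto)
    also have "\<dots> = d * sqrt w * exp (\<bar>\<delta>\<bar> * v - v\<^sup>2 / 2)"
      by (simp flip: exp_add)
    also have "\<dots> \<le> d * sqrt w * exp (\<delta>\<^sup>2 / 2)"
      using zero_le_power2[of "\<bar>\<delta>\<bar> - v"] d True by (intro mult_left_mono) (auto simp: power2_diff)
    also have "\<dots> = exp (\<delta>\<^sup>2 / 2) * nct_dominant n x z"
      using True by (simp add: nct_dominant_def z d_def)
    finally show ?thesis .
  next
    case False
    then show ?thesis
      by (auto simp: nct_integrand_def nct_dominant_def z gamma_density_eq_0 indicator_def)
  qed
qed

lemma integrable_nct_integrand: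
  assumes n: "n > 0" and x: "x \<ge> 0"
  shows "integrable (lborel \<Otimes>\<^sub>M lborel) (nct_integrand n x \<delta> k)"
proof (rule Bochner_Integration.integrable_bound)
  show "integrable (lborel \<Otimes>\<^sub>M lborel) (\<lambda>z. exp (\<delta>\<^sup>2 / 2) * nct_dominant n x z)"
    using integrable_nct_dominant[OF n x] by simp
  have "\<bar>nct_integrand n x \<delta> k z\<bar> \<le> (\<Sum>j<Suc k. \<bar>nct_integrand n x \<delta> j z\<bar>)" for z
    by (rule member_le_sum) auto
  then have "\<bar>nct_integrand n x \<delta> k z\<bar> \<le> exp (\<delta>\<^sup>2 / 2) * nct_dominant n x z" for z
    using sum_abs_nct_integrand_le[OF n x] by (rule order_trans)
  then show "AE z in lborel \<Otimes>\<^sub>M lborel. norm (nct_integrand n x \<delta> k z) \<le> norm (exp (\<delta>\<^sup>2 / 2) * nct_dominant n x z)"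
    by (intro AE_I2) (smt (verit) real_norm_def)
qed measurable

text \<open>Integrating over w first is a Gamma integral of rate (n + u^2) / 2, and the u-integral
  that remains is an incomplete beta function. Gamma (a + p) cancels against the Beta normalization
  and Gamma p is rewritten by duplication.\<close>

lemma integral_nct_integrand:
  assumes n: "n > 0" and x: "x \<ge> 0"
  shows "integral\<^sup>L (lborel \<Otimes>\<^sub>M lborel) (nct_integrand n x \<delta> k) = sqrt (2 * pi) / 2 * nct_term n x \<delta> k"
proof -
  define a where "a = n / 2"
  define p where "p = (real k + 1) / 2"
  have a: "a > 0" and p: "p > 0" using n by (auto simp: a_def p_def)
  note int = integrable_nct_integrand[OF n x, of \<delta> k]
  define C where "C = \<delta> ^ k / fact k * (a powr a / Gamma a * Gamma (a + p) * 2 powr (a + p))"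
  have inner: "(\<integral>w. nct_integrand n x \<delta> k (w, u) \<partial>lborel) =
        C * (indicator {0..x} u * (u ^ k * (n + u\<^sup>2) powr - (n / 2 + p)))" for u
  proof -
    have pos: "a + u\<^sup>2 / 2 > 0" using a by (simp add: add_pos_nonneg)
    have "(\<integral>w. nct_integrand n x \<delta> k (w, u) \<partial>lborel) =
        (\<integral>w. indicator {0..x} u * ((\<delta> * u) ^ k / fact k) * (gamma_density a w * (w powr p * exp (- (u\<^sup>2 / 2) * w))) \<partial>lborel)"
      by (simp add: nct_integrand_def a_def p_def mult_ac)
    also have "\<dots> = indicator {0..x} u * ((\<delta> * u) ^ k / fact k) * (\<integral>w. gamma_density a w * (w powr p * exp (- (u\<^sup>2 / 2) * w)) \<partial>lborel)"
      by simp
    also have "(\<integral>w. gamma_density a w * (w powr p * exp (- (u\<^sup>2 / 2) * w)) \<partial>lborel) =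
        a powr a / Gamma a * (Gamma (a + p) / (a + u\<^sup>2 / 2) powr (a + p))"
      using a p pos by (intro has_bochner_integral_integral_eq has_bochner_integral_gamma_density) auto
    also have "a + u\<^sup>2 / 2 = (n + u\<^sup>2) / 2"
      by (simp add: a_def field_simps)
    also have "((n + u\<^sup>2) / 2) powr (a + p) = (n + u\<^sup>2) powr (a + p) / 2 powr (a + p)"
      using n by (simp add: powr_divide)
    finally show ?thesis
      unfolding a_def[symmetric] powr_minus_divide by (simp add: C_def power_mult_distrib mult_ac)
  qed
  have "integral\<^sup>L (lborel \<Otimes>\<^sub>M lborel) (nct_integrand n x \<delta> k) =
        (\<integral>u. (\<integral>w. nct_integrand n x \<delta> k (w, u) \<partial>lborel) \<partial>lborel)"
    using lborel_pair.integral_snd[of "\<lambda>w u. nct_integrand n x \<delta> k (w, u)"] int by simp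
  also have "\<dots> = C * (Beta p (n / 2) * inc_beta (nct_y n x) p (n / 2) / (2 * n powr (n / 2)))"
    unfolding inner integral_mult_right_zero p_def inc_beta_substitution[OF n x] ..
  also have "\<dots> = sqrt (2 * pi) / 2 * nct_term n x \<delta> k"
  proof -
    have G: "Gamma a \<noteq> 0" "Gamma (a + p) \<noteq> 0"
      using a p by (simp_all add: Gamma_real_pos less_imp_neq[THEN not_sym])
    have p2: "p + 1/2 = real k / 2 + 1"
      by (simp add: p_def field_simps)
    have dup: "Gamma p * Gamma (p + 1/2) = sqrt pi / 2 ^ k * fact k"
      unfolding p2 unfolding p_def by (rule Gamma_half_mult_Gamma_half_Suc)
    have Gp: "Gamma (p + 1/2) > 0" using p by (intro Gamma_real_pos) auto
    have na: "n powr a = a powr a * 2 powr a"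
      using n by (simp add: a_def powr_divide)
    have 2: "2 powr (a + p) = 2 powr a * (sqrt 2 * sqrt 2 ^ k)"
      using powr_half_Suc[of 2 k] by (simp add: powr_add p_def)
    have 4: "(2::real) ^ k = sqrt 2 ^ k * sqrt 2 ^ k"
      by (simp flip: power_mult_distrib)
    have ne: "a powr a \<noteq> 0" "2 powr a \<noteq> (0::real)" using a by auto
    have "C * (Beta p a * inc_beta (nct_y n x) p a / (2 * n powr a)) =
          \<delta> ^ k / fact k * Gamma p * (sqrt 2 * sqrt 2 ^ k) * inc_beta (nct_y n x) p a / 2"
      unfolding C_def Beta_def na 2 using G ne by (simp add: field_simps add.commute)
    also have "Gamma p = sqrt pi / 2 ^ k * fact k / Gamma (p + 1/2)"
      using dup Gp by (simp add: field_simps)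
    finally show ?thesis
      unfolding nct_term_def p2[symmetric] p_def[symmetric] a_def[symmetric] 4 real_sqrt_mult
      using Gp by (simp add: power_divide mult_ac)
  qed
  finally show ?thesis .
qed

text \<open>The double integral of the full series \<open>S\<close> is computed twice: termwise by
  dominated convergence, and by integrating over u first, which gives erfc. Comparing the constants
  \<open>sqrt (2 * pi) / 2\<close> and \<open>sqrt (2 * pi) * exp (\<delta>\<^sup>2 / 2)\<close>
  leaves the prefactor of \<open>nct_P\<close> and \<open>nct_Q\<close>.\<close>

lemma nct_term_sums:
  assumes n: "n > 0" and x: "x \<ge> 0"
  shows "integrable lborel (\<lambda>w. gamma_density (n / 2) w * (erfc ((\<delta> - x * sqrt w) / sqrt 2) / 2 - erfc (\<delta> / sqrt 2) / 2))"
    and "(\<lambda>k. exp (- \<delta>\<^sup>2 / 2) / 2 * nct_term n x \<delta> k) sums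
           (\<integral>w. gamma_density (n / 2) w * (erfc ((\<delta> - x * sqrt w) / sqrt 2) / 2 - erfc (\<delta> / sqrt 2) / 2) \<partial>lborel)"
proof -
  define S where "S = (\<lambda>(w, u). gamma_density (n / 2) w * (indicator {0..x} u * (sqrt w * exp (\<delta> * (u * sqrt w) - (u * sqrt w)\<^sup>2 / 2))))"
  have S_meas [measurable]: "S \<in> borel_measurable (lborel \<Otimes>\<^sub>M lborel)"
    unfolding S_def by measurable
  have S_sums: "(\<lambda>k. nct_integrand n x \<delta> k z) sums S z" for z
  proof -
    obtain w u where z: "z = (w, u)" by (cases z)
    show ?thesis
    proof (cases "w > 0")
      case True
      have eq: "nct_integrand n x \<delta> k z = gamma_density (n / 2) w * indicator {0..x} u * sqrt w * exp (- (u * sqrt w)\<^sup>2 / 2) *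
              ((\<delta> * (u * sqrt w)) ^ k / fact k)" for k
        using True by (simp add: nct_integrand_def z powr_half_Suc power_mult_distrib)
      have "(\<lambda>k. (\<delta> * (u * sqrt w)) ^ k / fact k) sums exp (\<delta> * (u * sqrt w))"
        using exp_converges[of "\<delta> * (u * sqrt w)"] by (simp add: field_simps)
      then have "(\<lambda>k. nct_integrand n x \<delta> k z) sums (gamma_density (n / 2) w * indicator {0..x} u * sqrt w * exp (- (u * sqrt w)\<^sup>2 / 2) * exp (\<delta> * (u * sqrt w)))"
        unfolding eq by (rule sums_mult)
      also have "gamma_density (n / 2) w * indicator {0..x} u * sqrt w * exp (- (u * sqrt w)\<^sup>2 / 2) * exp (\<delta> * (u * sqrt w)) = S z"
      proof -
        have "exp (\<delta> * (u * sqrt w) - (u * sqrt w)\<^sup>2 / 2) = exp (- (u * sqrt w)\<^sup>2 / 2) * exp (\<delta> * (u * sqrt w))"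
          by (simp flip: exp_add)
        then show ?thesis by (simp only: S_def z prod.case mult_ac)
      qed
      finally show ?thesis .
    next
      case False
      then show ?thesis by (simp add: nct_integrand_def S_def z gamma_density_eq_0)
    qed
  qed
  have dom_int: "integrable (lborel \<Otimes>\<^sub>M lborel) (\<lambda>z. exp (\<delta>\<^sup>2 / 2) * nct_dominant n x z)"
    using integrable_nct_dominant[OF n x] by simp
  have lim: "AE z in lborel \<Otimes>\<^sub>M lborel. (\<lambda>K. \<Sum>k<K. nct_integrand n x \<delta> k z) \<longlonglongrightarrow> S z"
    using S_sums unfolding sums_def by (intro AE_I2)
  have bound: "AE z in lborel \<Otimes>\<^sub>M lborel. norm (\<Sum>k<K. nct_integrand n x \<delta> k z) \<le> exp (\<delta>\<^sup>2 / 2) * nct_dominant n x z" for K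
  proof (intro AE_I2)
    fix z
    have "norm (\<Sum>k<K. nct_integrand n x \<delta> k z) \<le> (\<Sum>k<K. \<bar>nct_integrand n x \<delta> k z\<bar>)"
      by simp
    also note sum_abs_nct_integrand_le[OF n x]
    finally show "norm (\<Sum>k<K. nct_integrand n x \<delta> k z) \<le> exp (\<delta>\<^sup>2 / 2) * nct_dominant n x z" .
  qed
  have S_int: "integrable (lborel \<Otimes>\<^sub>M lborel) S"
    by (rule integrable_dominated_convergence[OF _ _ dom_int lim bound]) measurable
  have "(\<lambda>K. integral\<^sup>L (lborel \<Otimes>\<^sub>M lborel) (\<lambda>z. \<Sum>k<K. nct_integrand n x \<delta> k z)) \<longlonglongrightarrow> integral\<^sup>L (lborel \<Otimes>\<^sub>M lborel) S"
    by (rule integral_dominated_convergence[OF _ _ dom_int lim bound]) measurable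
  then have S_lim: "(\<lambda>k. sqrt (2 * pi) / 2 * nct_term n x \<delta> k) sums integral\<^sup>L (lborel \<Otimes>\<^sub>M lborel) S"
    unfolding sums_def
    by (simp add: Bochner_Integration.integral_sum integrable_nct_integrand[OF n x] integral_nct_integrand[OF n x])
  let ?c = "sqrt (2 * pi) * exp (\<delta>\<^sup>2 / 2)"
  let ?H = "\<lambda>w. gamma_density (n / 2) w * (erfc ((\<delta> - x * sqrt w) / sqrt 2) / 2 - erfc (\<delta> / sqrt 2) / 2)"
  have inner: "(\<integral>u. S (w, u) \<partial>lborel) = ?c * ?H w" for w
  proof -
    let ?h = "\<lambda>u. sqrt w * exp (\<delta> * (u * sqrt w) - (u * sqrt w)\<^sup>2 / 2)"
    have "set_integrable lborel {0..x} ?h"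
      by (intro borel_integrable_atLeastAtMost' continuous_intros) simp_all
    then have "(LINT u:{0..x}|lborel. ?h u) = integral {0..x} ?h"
      by (rule set_borel_integral_eq_integral)
    also have "\<dots> = ?c * (erfc ((\<delta> - x * sqrt w) / sqrt 2) / 2 - erfc (\<delta> / sqrt 2) / 2)"
      using gauss_interval_has_integral[OF x] by (rule integral_unique)
    finally have "(LINT u:{0..x}|lborel. ?h u) = \<dots>" .
    then show ?thesis
      by (simp only: S_def prod.case integral_mult_right_zero set_lebesgue_integral_def real_scaleR_def)
         (simp only: mult_ac)
  qed
  have "integrable lborel (\<lambda>w. ?c * ?H w)"
    using lborel_pair.integrable_fst'[OF S_int] unfolding inner .
  then have "integrable lborel (\<lambda>w. 1 / ?c * (?c * ?H w))"
    by (rule integrable_mult_right)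
  then show "integrable lborel ?H"
    by simp
  have "integral\<^sup>L (lborel \<Otimes>\<^sub>M lborel) S = ?c * (\<integral>w. ?H w \<partial>lborel)"
    unfolding lborel_pair.integral_fst'[OF S_int, symmetric] inner by simp
  with sums_mult[OF S_lim, of "1 / ?c"]
  show "(\<lambda>k. exp (- \<delta>\<^sup>2 / 2) / 2 * nct_term n x \<delta> k) sums (\<integral>w. ?H w \<partial>lborel)"
    by (simp add: exp_minus field_simps)
qed

section \<open>Absolute convergence and the split into even and odd terms\<close>

lemma inc_beta_nonneg: "a > 0 \<Longrightarrow> b > 0 \<Longrightarrow> inc_beta y a b \<ge> 0"
  unfolding inc_beta_def
  \<comment> \<open>By convention \<open>integral\<close> is 0 for a function that is not
    integrable, so both cases give a nonnegative value.\<close>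
  by (cases "(\<lambda>t. t powr (a - 1) * (1 - t) powr (b - 1)) integrable_on {0..y}")
     (auto intro!: mult_nonneg_nonneg divide_nonneg_nonneg integral_nonneg Gamma_real_pos[THEN less_imp_le]
        simp: Beta_def not_integrable_integral)

lemma abs_nct_term:
  assumes "n > 0"
  shows "\<bar>nct_term n x \<delta> k\<bar> = nct_term n x \<bar>\<delta>\<bar> k"
  using assms inc_beta_nonneg[of "(real k + 1) / 2" "n / 2" "nct_y n x"] Gamma_real_pos[of "real k / 2 + 1"]
  by (simp add: nct_term_def abs_mult power_abs)

text \<open>Absolute convergence costs nothing: the absolute values of the terms at \<delta> are the
  terms at |\<delta>|, whose series is already known to converge. Subseries then converge as
  well.\<close>

lemma summable_nct_term_comp:
  assumes n: "n > 0" and x: "x \<ge> 0" and f: "inj f"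
  shows "summable (\<lambda>j. nct_term n x \<delta> (f j))"
proof (rule summable_norm_cancel)
  have "summable (nct_term n x \<bar>\<delta>\<bar>)"
    using nct_term_sums(2)[OF n x, of "\<bar>\<delta>\<bar>", THEN sums_summable] by (simp add: summable_cmult_iff)
  then have "summable (nct_term n x \<bar>\<delta>\<bar> \<circ> f)"
    using f by (rule summable_reindex) (simp flip: abs_nct_term[OF n])
  then show "summable (\<lambda>j. norm (nct_term n x \<delta> (f j)))"
    by (simp add: abs_nct_term[OF n] o_def)
qed

text \<open>\<open>nct_P\<close> and \<open>nct_Q\<close> are separate infinite sums, so each must
  converge by itself before they can be interleaved; after that, the combined series is grouped in
  blocks of length 2.\<close>

lemma nct_P_plus_nct_Q:
  assumes n: "n > 0" and x: "x \<ge> 0"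
  shows "nct_P n x \<delta> + nct_Q n x \<delta> =
    (\<integral>w. gamma_density (n / 2) w * (erfc ((\<delta> - x * sqrt w) / sqrt 2) / 2 - erfc (\<delta> / sqrt 2) / 2) \<partial>lborel)"
proof -
  let ?e = "exp (- \<delta>\<^sup>2 / 2) / 2"
  let ?t = "nct_term n x \<delta>"
  have pow: "(\<delta> / sqrt 2) ^ (2 * j) = (\<delta>\<^sup>2 / 2) ^ j" for j
    by (simp add: power_mult power_divide)
  have half: "(real (2 * j) + 1) / 2 = real j + 1/2" "real (2 * j) / 2 + 1 = 1 + real j"
    "(real (Suc (2 * j)) + 1) / 2 = real j + 1" "real (Suc (2 * j)) / 2 + 1 = real j + 3/2" for j
    by (simp_all add: field_simps)
  have even: "?t (2 * j) = (\<delta>\<^sup>2 / 2) ^ j / fact j * inc_beta (nct_y n x) (real j + 1/2) (n / 2)" for j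
    unfolding nct_term_def half pow Gamma_fact ..
  have odd: "?t (Suc (2 * j)) = \<delta> / sqrt 2 * ((\<delta>\<^sup>2 / 2) ^ j / Gamma (real j + 3/2)) * inc_beta (nct_y n x) (real j + 1) (n / 2)" for j
    unfolding nct_term_def half power_Suc pow by simp
  have "nct_P n x \<delta> + nct_Q n x \<delta> = ?e * ((\<Sum>j. ?t (2 * j)) + (\<Sum>j. ?t (Suc (2 * j))))"
    unfolding nct_P_def nct_Q_def even odd by (simp add: algebra_simps)
  also have "(\<Sum>j. ?t (2 * j)) + (\<Sum>j. ?t (Suc (2 * j))) = (\<Sum>j. ?t (2 * j) + ?t (Suc (2 * j)))"
    by (intro suminf_add summable_nct_term_comp[OF n x]) (auto simp: inj_def)
  also have "?e * \<dots> = (\<Sum>j. ?e * (?t (2 * j) + ?t (Suc (2 * j))))"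
    by (intro suminf_mult[symmetric] summable_add summable_nct_term_comp[OF n x]) (auto simp: inj_def)
  also have "(\<lambda>j. ?e * (?t (2 * j) + ?t (Suc (2 * j)))) = (\<lambda>j. sum (\<lambda>k. ?e * ?t k) {j * 2..<j * 2 + 2})"
    by (simp add: numeral_2_eq_2 algebra_simps)
  also have "suminf \<dots> = (\<integral>w. gamma_density (n / 2) w * (erfc ((\<delta> - x * sqrt w) / sqrt 2) / 2 - erfc (\<delta> / sqrt 2) / 2) \<partial>lborel)"
    by (intro sums_unique[symmetric] sums_group nct_term_sums[OF n x]) simp
  finally show ?thesis .
qed

definition mixed_cdf :: "real \<Rightarrow> real \<Rightarrow> real \<Rightarrow> real" where
  "mixed_cdf x \<delta> w = erfc ((\<delta> - x * sqrt w) / sqrt 2) / 2"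

text \<open>The first summand of \<open>nct_F\<close> does not depend on w; by the zeroth moment it
  restores the value at u = 0 that was subtracted in the u-integration.\<close>

lemma has_bochner_integral_nct_F:
  assumes n: "n > 0" and x: "x \<ge> 0"
  shows "has_bochner_integral lborel (\<lambda>w. gamma_density (n / 2) w * mixed_cdf x \<delta> w) (nct_F n x \<delta>)"
proof -
  let ?h = "\<lambda>w. gamma_density (n / 2) w * (erfc ((\<delta> - x * sqrt w) / sqrt 2) / 2 - erfc (\<delta> / sqrt 2) / 2)"
  have "has_bochner_integral lborel ?h (nct_P n x \<delta> + nct_Q n x \<delta>)"
    unfolding nct_P_plus_nct_Q[OF n x] using nct_term_sums(1)[OF n x] by (rule has_bochner_integral_integrable)
  moreover have "has_bochner_integral lborel (\<lambda>w. gamma_density (n / 2) w * w ^ 0 * (erfc (\<delta> / sqrt 2) / 2))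
      (pochhammer (n / 2) 0 / (n / 2) ^ 0 * (erfc (\<delta> / sqrt 2) / 2))"
    using n by (intro has_bochner_integral_mult_left has_bochner_integral_gamma_moment) auto
  ultimately have "has_bochner_integral lborel (\<lambda>w. ?h w + gamma_density (n / 2) w * w ^ 0 * (erfc (\<delta> / sqrt 2) / 2))
      (nct_P n x \<delta> + nct_Q n x \<delta> + pochhammer (n / 2) 0 / (n / 2) ^ 0 * (erfc (\<delta> / sqrt 2) / 2))"
    by (rule has_bochner_integral_add)
  then show ?thesis
    by (simp add: mixed_cdf_def nct_F_def algebra_simps)
qed

section \<open>Taylor expansion of the mixed distribution function\<close>

text \<open>Up to a Gaussian factor the derivatives of \<open>mixed_cdf\<close> in \<open>w\<close> are polynomials in \<open>t = 1 / sqrt w\<close>; the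
  recursion comes from \<open>dt / dw = - t^3 / 2\<close>.\<close>

primrec deriv_poly :: "real \<Rightarrow> real \<Rightarrow> nat \<Rightarrow> real poly" where
  "deriv_poly x \<delta> 0 = [:0, 1/2:]"
| "deriv_poly x \<delta> (Suc k) =
     [:- x\<^sup>2 / 2, x * \<delta> / 2:] * deriv_poly x \<delta> k - [:0, 0, 0, 1/2:] * pderiv (deriv_poly x \<delta> k)"

primrec mixed_cdf_deriv :: "real \<Rightarrow> real \<Rightarrow> nat \<Rightarrow> real \<Rightarrow> real" where
  "mixed_cdf_deriv x \<delta> 0 w = mixed_cdf x \<delta> w"
| "mixed_cdf_deriv x \<delta> (Suc k) w =
     x * (exp (- (\<delta> - x * sqrt w)\<^sup>2 / 2) / sqrt (2 * pi)) * poly (deriv_poly x \<delta> k) (1 / sqrt w)"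

text \<open>In terms of t = 1 / sqrt w the logarithmic derivative of the Gaussian factor is
  (\<delta> - x / t) x t / 2 = x \<delta> t / 2 - x^2 / 2: the pole cancels, so the cofactor stays a
  polynomial in t.\<close>

lemma has_real_derivative_mixed_cdf_deriv:
  assumes w: "w > 0"
  shows "(mixed_cdf_deriv x \<delta> k has_real_derivative mixed_cdf_deriv x \<delta> (Suc k) w) (at w)"
proof (cases k)
  case 0
  have "((\<lambda>w. erfc ((\<delta> - x * sqrt w) / sqrt 2) / 2) has_real_derivative
      - 2 / sqrt pi * exp (- ((\<delta> - x * sqrt w) / sqrt 2)\<^sup>2) * (- (x * (inverse (sqrt w) / 2)) / sqrt 2) / 2) (at w)"
    by (rule DERIV_cdivide has_real_derivative_erfc)+ (use w in \<open>auto intro!: derivative_eq_intros\<close>)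
  moreover have "- 2 / sqrt pi * exp (- ((\<delta> - x * sqrt w) / sqrt 2)\<^sup>2) * (- (x * (inverse (sqrt w) / 2)) / sqrt 2) / 2 =
      mixed_cdf_deriv x \<delta> (Suc 0) w"
    by (simp add: power_divide real_sqrt_mult field_simps)
  ultimately show ?thesis
    unfolding 0 mixed_cdf_deriv.simps(1)[abs_def] mixed_cdf_def by (simp only:)
next
  case (Suc j)
  let ?p = "deriv_poly x \<delta> j"
  define t where "t = 1 / sqrt w"
  have t: "sqrt w = 1 / t" "t > 0" using w by (auto simp: t_def)
  have dt: "((\<lambda>w. 1 / sqrt w) has_real_derivative - (t ^ 3) / 2) (at w)"
    using w by (auto intro!: derivative_eq_intros simp: t_def power3_eq_cube field_simps)
  have dp: "((\<lambda>w. poly ?p (1 / sqrt w)) has_real_derivative poly (pderiv ?p) t * (- (t ^ 3) / 2)) (at w)"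
    using DERIV_chain2[OF poly_DERIV dt, of ?p] by (simp add: t_def)
  have ds: "(sqrt has_real_derivative t / 2) (at w)"
    using DERIV_real_sqrt[OF w] by (simp add: t_def inverse_eq_divide)
  have de: "((\<lambda>w. exp (- (\<delta> - x * sqrt w)\<^sup>2 / 2)) has_real_derivative
      exp (- (\<delta> - x * sqrt w)\<^sup>2 / 2) * ((\<delta> - x * (1 / t)) * (x * (t / 2)))) (at w)"
    by (rule DERIV_fun_exp,
        rule DERIV_cong[OF DERIV_cdivide[OF DERIV_minus[OF DERIV_power[OF DERIV_diff[OF DERIV_const DERIV_cmult[OF ds]]]]]])
       (simp add: t(1))
  have "(\<delta> - x * (1 / t)) * (x * (t / 2)) = - x\<^sup>2 / 2 + t * (x * \<delta> / 2)"
    using t(2) by (simp add: power2_eq_square field_simps)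
  note de = de[unfolded this]
  have "(mixed_cdf_deriv x \<delta> (Suc j) has_real_derivative
     x * (exp (- (\<delta> - x * sqrt w)\<^sup>2 / 2) / sqrt (2 * pi)) *
       ((- x\<^sup>2 / 2 + t * (x * \<delta> / 2)) * poly ?p t + poly (pderiv ?p) t * (- (t ^ 3) / 2))) (at w)"
    unfolding mixed_cdf_deriv.simps(2)[abs_def]
  proof (rule DERIV_cong[OF DERIV_mult[OF _ dp]])
    show "((\<lambda>w. x * (exp (- (\<delta> - x * sqrt w)\<^sup>2 / 2) / sqrt (2 * pi))) has_real_derivative
        x * (exp (- (\<delta> - x * sqrt w)\<^sup>2 / 2) / sqrt (2 * pi)) * (- x\<^sup>2 / 2 + t * (x * \<delta> / 2))) (at w)"
      by (rule DERIV_cong[OF DERIV_cmult[OF DERIV_cdivide[OF de]]]) simp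
  qed (simp only: t_def[symmetric] algebra_simps)
  also have "(- x\<^sup>2 / 2 + t * (x * \<delta> / 2)) * poly ?p t + poly (pderiv ?p) t * (- (t ^ 3) / 2) =
     poly (deriv_poly x \<delta> (Suc j)) t"
    by (simp add: power3_eq_cube algebra_simps)
  finally show ?thesis
    unfolding Suc mixed_cdf_deriv.simps(2) t_def .
qed

section \<open>Derivative bounds, uniform for bounded x and \<delta>\<close>

lemma degree_deriv_poly: "degree (deriv_poly x \<delta> k) \<le> 2 * k + 1"
proof (induction k)
  case (Suc k)
  have "degree ([:- x\<^sup>2 / 2, x * \<delta> / 2:] * deriv_poly x \<delta> k) \<le> 1 + (2 * k + 1)"
    by (rule order_trans[OF degree_mult_le add_mono[OF _ Suc]]) simp
  \<comment> \<open>Differentiating and multiplying by t^3 raises the degree by 2; this is the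
    faster of the two growths.\<close>
  moreover have "degree ([:0, 0, 0, 1/2:] * pderiv (deriv_poly x \<delta> k)) \<le> 3 + (2 * k + 1 - 1)"
    by (rule order_trans[OF degree_mult_le add_mono]) (use Suc in \<open>auto simp: degree_pderiv\<close>)
  ultimately show ?case
    unfolding deriv_poly.simps by (intro degree_diff_le) auto
qed simp

lemma coeff_deriv_poly_bounded:
  "\<exists>C\<ge>0. \<forall>x \<delta> i. \<bar>x\<bar> \<le> X \<longrightarrow> \<bar>\<delta>\<bar> \<le> D \<longrightarrow> \<bar>coeff (deriv_poly x \<delta> k) i\<bar> \<le> C"
proof (induction k)
  case 0
  show ?case
    by (rule exI[of _ 1]) (auto simp: coeff_pCons split: nat.splits)
next
  case (Suc k)
  then obtain C where C0: "C \<ge> 0"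
    and C: "\<bar>x\<bar> \<le> X \<Longrightarrow> \<bar>\<delta>\<bar> \<le> D \<Longrightarrow> \<bar>coeff (deriv_poly x \<delta> k) i\<bar> \<le> C" for x \<delta> i
    by blast
  \<comment> \<open>One summand for each contribution to the recursion. The factor k + 1 comes from
    differentiation, since l + 1 \<le> 2 k + 1; the absolute value keeps \<open>C'\<close>
    nonnegative for bounds X, D of any sign.\<close>
  define C' where "C' = X\<^sup>2 / 2 * C + \<bar>X * D\<bar> / 2 * C + (real k + 1) * C"
  have "\<bar>coeff (deriv_poly x \<delta> (Suc k)) i\<bar> \<le> C'" if x: "\<bar>x\<bar> \<le> X" and \<delta>: "\<bar>\<delta>\<bar> \<le> D" for x \<delta> i
  proof -
    let ?p = "deriv_poly x \<delta> k"
    note Cp = C[OF x \<delta>]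
    have 1: "\<bar>- x\<^sup>2 / 2 * coeff ?p i\<bar> \<le> X\<^sup>2 / 2 * C"
      unfolding abs_mult by (intro mult_mono Cp) (use x power_mono[of "\<bar>x\<bar>" X 2] in auto)
    have 2: "\<bar>x * \<delta> / 2 * coeff ?p l\<bar> \<le> \<bar>X * D\<bar> / 2 * C" for l
      unfolding abs_mult
      by (intro mult_mono Cp) (use x \<delta> in \<open>auto simp: abs_mult intro!: mult_mono\<close>)
    have 3: "\<bar>coeff (pderiv ?p) l / 2\<bar> \<le> (real k + 1) * C" for l
    proof (cases "Suc l \<le> 2 * k + 1")
      case True
      have "\<bar>coeff (pderiv ?p) l / 2\<bar> = real (Suc l) / 2 * \<bar>coeff ?p (Suc l)\<bar>"
        by (simp add: coeff_pderiv abs_mult)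
      also have "\<dots> \<le> (real k + 1) * C"
        by (intro mult_mono Cp) (use True in auto)
      finally show ?thesis .
    next
      case False
      then have "coeff ?p (Suc l) = 0"
        using degree_deriv_poly[of x \<delta> k] by (intro coeff_eq_0) auto
      then show ?thesis using C0 by (simp add: coeff_pderiv)
    qed
    have "coeff (deriv_poly x \<delta> (Suc k)) i = - x\<^sup>2 / 2 * coeff ?p i
        + (case i of 0 \<Rightarrow> 0 | Suc l \<Rightarrow> x * \<delta> / 2 * coeff ?p l)
        - (case i of Suc (Suc (Suc l)) \<Rightarrow> coeff (pderiv ?p) l / 2 | _ \<Rightarrow> 0)"
      by (auto simp: coeff_pCons split: nat.splits)
    moreover have "\<bar>case i of 0 \<Rightarrow> 0 | Suc l \<Rightarrow> x * \<delta> / 2 * coeff ?p l\<bar> \<le> \<bar>X * D\<bar> / 2 * C"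
      using 2 C0 by (cases i) auto
    moreover have "\<bar>case i of Suc (Suc (Suc l)) \<Rightarrow> coeff (pderiv ?p) l / 2 | _ \<Rightarrow> 0\<bar> \<le> (real k + 1) * C"
      using 3 C0 by (auto split: nat.splits)
    ultimately show ?thesis
      using 1 unfolding C'_def by linarith
  qed
  moreover have "C' \<ge> 0"
    using C0 by (simp add: C'_def)
  ultimately show ?case by blast
qed

text \<open>The radius 2 covers t = 1 / sqrt w for all w \<ge> 1/2, and in particular the expansion
  point t = 1.\<close>

lemma poly_deriv_poly_bounded:
  "\<exists>C\<ge>0. \<forall>x \<delta> t. \<bar>x\<bar> \<le> X \<longrightarrow> \<bar>\<delta>\<bar> \<le> D \<longrightarrow> \<bar>t\<bar> \<le> 2 \<longrightarrow> \<bar>poly (deriv_poly x \<delta> k) t\<bar> \<le> C"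
proof -
  obtain C where C0: "C \<ge> 0"
    and C: "\<bar>x\<bar> \<le> X \<Longrightarrow> \<bar>\<delta>\<bar> \<le> D \<Longrightarrow> \<bar>coeff (deriv_poly x \<delta> k) i\<bar> \<le> C" for x \<delta> i
    using coeff_deriv_poly_bounded[of X D k] by blast
  have "\<bar>poly (deriv_poly x \<delta> k) t\<bar> \<le> (\<Sum>i\<le>2 * k + 1. C * 2 ^ i)"
    if "\<bar>x\<bar> \<le> X" "\<bar>\<delta>\<bar> \<le> D" "\<bar>t\<bar> \<le> 2" for x \<delta> t
  proof -
    have "\<bar>poly (deriv_poly x \<delta> k) t\<bar> \<le> (\<Sum>i\<le>degree (deriv_poly x \<delta> k). \<bar>coeff (deriv_poly x \<delta> k) i\<bar> * \<bar>t\<bar> ^ i)"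
      unfolding poly_altdef by (rule order_trans[OF sum_abs]) (simp add: abs_mult power_abs)
    also have "\<dots> \<le> (\<Sum>i\<le>degree (deriv_poly x \<delta> k). C * 2 ^ i)"
      using C that C0 by (intro sum_mono mult_mono power_mono) auto
    also have "\<dots> \<le> (\<Sum>i\<le>2 * k + 1. C * 2 ^ i)"
      using degree_deriv_poly[of x \<delta> k] C0 by (intro sum_mono2) auto
    finally show ?thesis .
  qed
  moreover have "(\<Sum>i\<le>2 * k + 1. C * 2 ^ i) \<ge> 0"
    using C0 by (intro sum_nonneg) auto
  ultimately show ?thesis by blast
qed

text \<open>The factor x is kept outside the constant because the error is later divided by
  \<open>nct_B x \<delta>\<close>.\<close>

lemma mixed_cdf_deriv_bounded:
  "\<exists>C\<ge>0. \<forall>x \<delta> w. 0 \<le> x \<longrightarrow> x \<le> X \<longrightarrow> \<bar>\<delta>\<bar> \<le> D \<longrightarrow> w \<ge> 1/2 \<longrightarrow>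
     \<bar>mixed_cdf_deriv x \<delta> (Suc k) w\<bar> \<le> C * x"
proof -
  obtain C where C0: "C \<ge> 0"
    and C: "\<bar>x\<bar> \<le> X \<Longrightarrow> \<bar>\<delta>\<bar> \<le> D \<Longrightarrow> \<bar>t\<bar> \<le> 2 \<Longrightarrow> \<bar>poly (deriv_poly x \<delta> k) t\<bar> \<le> C" for x \<delta> t
    using poly_deriv_poly_bounded[of X D k] by blast
  have "\<bar>mixed_cdf_deriv x \<delta> (Suc k) w\<bar> \<le> C * x"
    if "0 \<le> x" "x \<le> X" "\<bar>\<delta>\<bar> \<le> D" "w \<ge> 1/2" for x \<delta> w
  proof -
    have "sqrt w \<ge> 1/2"
      using that by (intro real_le_rsqrt) (auto simp: power2_eq_square)
    then have "1 / sqrt w \<le> 1 / (1/2)"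
      by (intro frac_le) auto
    then have "\<bar>1 / sqrt w\<bar> \<le> 2"
      using that by simp
    then have p: "\<bar>poly (deriv_poly x \<delta> k) (1 / sqrt w)\<bar> \<le> C"
      using that by (intro C) auto
    have "exp (- (\<delta> - x * sqrt w)\<^sup>2 / 2) \<le> 1"
      by simp
    moreover have "sqrt (2 * pi) \<ge> 1"
      using pi_gt3 by (intro real_le_rsqrt) auto
    ultimately have "exp (- (\<delta> - x * sqrt w)\<^sup>2 / 2) / sqrt (2 * pi) \<le> 1 / 1"
      by (intro frac_le) auto
    then have "\<bar>mixed_cdf_deriv x \<delta> (Suc k) w\<bar> \<le> x * 1 * C"
      using that C0 p unfolding mixed_cdf_deriv.simps abs_mult
      by (intro mult_mono) auto
    then show ?thesis by (simp add: mult.commute)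
  qed
  then show ?thesis using C0 by blast
qed

text \<open>The derivative is at most 2 / sqrt pi in absolute value. For small w this Lipschitz
  bound supplies the factor x that the derivatives supply elsewhere.\<close>

lemma abs_erfc_diff_le: "\<bar>erfc a - erfc b\<bar> \<le> 2 * \<bar>a - b\<bar>"
proof -
  have "norm (erfc a - erfc b) \<le> 2 * norm (a - b)"
  proof (rule field_differentiable_bound[where S = UNIV])
    fix z :: real
    show "(erfc has_real_derivative - 2 / sqrt pi * exp (- z\<^sup>2) * 1) (at z within UNIV)"
      by (rule has_real_derivative_erfc) (rule DERIV_ident)
    have "sqrt pi \<ge> 1"
      using pi_gt3 by (intro real_le_rsqrt) auto
    then have "2 / sqrt pi * exp (- z\<^sup>2) \<le> 2 / 1 * 1"
      by (intro mult_mono frac_le) auto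
    then show "norm (- 2 / sqrt pi * exp (- z\<^sup>2) * 1) \<le> 2"
      by (simp add: abs_mult)
  qed auto
  then show ?thesis by simp
qed

text \<open>For \<open>w < 1/2\<close>, where the derivatives blow up, the bound holds because \<open>(w - 1) ^ (2 * N + 2)\<close> is bounded
  away from 0; this makes tail estimates for the mixing law superfluous.\<close>

lemma mixed_cdf_taylor:
  fixes X D :: real and N :: nat
  shows "\<exists>C\<ge>0. \<forall>x \<delta> w. 0 \<le> x \<longrightarrow> x \<le> X \<longrightarrow> \<bar>\<delta>\<bar> \<le> D \<longrightarrow> w > 0 \<longrightarrow>
     \<bar>mixed_cdf x \<delta> w - (\<Sum>m<2 * N + 2. mixed_cdf_deriv x \<delta> m 1 / fact m * (w - 1) ^ m)\<bar>
       \<le> C * x * (w - 1) ^ (2 * N + 2)"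
proof -
  have "\<forall>k. \<exists>C\<ge>0. \<forall>x \<delta> w. 0 \<le> x \<longrightarrow> x \<le> X \<longrightarrow> \<bar>\<delta>\<bar> \<le> D \<longrightarrow> w \<ge> 1/2 \<longrightarrow>
     \<bar>mixed_cdf_deriv x \<delta> (Suc k) w\<bar> \<le> C * x"
    using mixed_cdf_deriv_bounded by blast
  then obtain C where C0: "C k \<ge> 0"
    and C: "0 \<le> x \<Longrightarrow> x \<le> X \<Longrightarrow> \<bar>\<delta>\<bar> \<le> D \<Longrightarrow> w \<ge> 1/2 \<Longrightarrow> \<bar>mixed_cdf_deriv x \<delta> (Suc k) w\<bar> \<le> C k * x"
    for k x \<delta> w
    by metis
  define M where "M = 2 * N + 1"
  have M: "2 * N + 2 = Suc M" "even (Suc M)" by (simp_all add: M_def)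
  \<comment> \<open>The 1 is the Lipschitz bound for the zeroth-order term, and \<open>C m\<close>
    bounds the derivative of order m + 1. For w < 1/2 the error is thus at most S x, and (2 (1 -
    w))^(M + 1) \<ge> 1 turns this into the second part of the final constant.\<close>
  define S where "S = 1 + (\<Sum>m<M. C m)"
  have S: "S \<ge> 0" using C0 by (simp add: S_def sum_nonneg)
  have "\<bar>mixed_cdf x \<delta> w - (\<Sum>m<Suc M. mixed_cdf_deriv x \<delta> m 1 / fact m * (w - 1) ^ m)\<bar>
       \<le> (C M + S * 2 ^ Suc M) * x * (w - 1) ^ Suc M"
    if x: "0 \<le> x" "x \<le> X" and \<delta>: "\<bar>\<delta>\<bar> \<le> D" and w: "w > 0" for x \<delta> w
  proof -
    \<comment> \<open>\<open>Taylor\<close> demands a point different from the centre, so w = 1 is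
      treated apart.\<close>
    consider "w = 1" | "w \<noteq> 1" "w \<ge> 1/2" | "w < 1/2" by linarith
    then show ?thesis
    proof cases
      case 1
      then show ?thesis by (simp add: sum.lessThan_Suc_shift del: sum.lessThan_Suc)
    next
      case 2
      have "\<exists>t. (if w < 1 then w < t \<and> t < 1 else 1 < t \<and> t < w) \<and>
        mixed_cdf x \<delta> w = (\<Sum>m<Suc M. mixed_cdf_deriv x \<delta> m 1 / fact m * (w - 1) ^ m)
            + mixed_cdf_deriv x \<delta> (Suc M) t / fact (Suc M) * (w - 1) ^ Suc M"
        by (rule Taylor[where a = "1/2" and b = "max w 1"])
           (use 2 in \<open>auto intro!: has_real_derivative_mixed_cdf_deriv simp del: mixed_cdf_deriv.simps(2)
              simp: fun_eq_iff\<close>)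
      then obtain t where t: "if w < 1 then w < t \<and> t < 1 else 1 < t \<and> t < w"
        and eq: "mixed_cdf x \<delta> w = (\<Sum>m<Suc M. mixed_cdf_deriv x \<delta> m 1 / fact m * (w - 1) ^ m)
            + mixed_cdf_deriv x \<delta> (Suc M) t / fact (Suc M) * (w - 1) ^ Suc M"
        by blast
      have "t \<ge> 1/2" using t 2 by (auto split: if_splits)
      then have "\<bar>mixed_cdf_deriv x \<delta> (Suc M) t\<bar> \<le> C M * x"
        using C x \<delta> by blast
      then have "\<bar>mixed_cdf_deriv x \<delta> (Suc M) t\<bar> / fact (Suc M) \<le> C M * x / 1"
        by (intro frac_le fact_ge_1) (use C0 x in auto)
      then have "\<bar>mixed_cdf_deriv x \<delta> (Suc M) t\<bar> / fact (Suc M) \<le> (C M + S * 2 ^ Suc M) * x"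
        using S x by (simp add: algebra_simps add_increasing2)
      then have "\<bar>mixed_cdf_deriv x \<delta> (Suc M) t\<bar> / fact (Suc M) * (w - 1) ^ Suc M
          \<le> (C M + S * 2 ^ Suc M) * x * (w - 1) ^ Suc M"
        using M(2) by (intro mult_right_mono zero_le_even_power)
      moreover have "\<bar>(w - 1) ^ Suc M\<bar> = (w - 1) ^ Suc M"
        using M(2) by (intro abs_of_nonneg zero_le_even_power)
      ultimately show ?thesis
        unfolding eq by (simp add: abs_mult abs_divide del: power_Suc mixed_cdf_deriv.simps fact_Suc sum.lessThan_Suc)
    next
      case 3
      have first: "\<bar>mixed_cdf x \<delta> w - mixed_cdf x \<delta> 1\<bar> \<le> x"
      proof -
        have "\<bar>mixed_cdf x \<delta> w - mixed_cdf x \<delta> 1\<bar> =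
              \<bar>erfc ((\<delta> - x * sqrt w) / sqrt 2) - erfc ((\<delta> - x * sqrt 1) / sqrt 2)\<bar> / 2"
          by (simp add: mixed_cdf_def diff_divide_distrib[symmetric] abs_divide)
        also have "\<dots> \<le> \<bar>(\<delta> - x * sqrt w) / sqrt 2 - (\<delta> - x * sqrt 1) / sqrt 2\<bar>"
          using abs_erfc_diff_le[of "(\<delta> - x * sqrt w) / sqrt 2" "(\<delta> - x * sqrt 1) / sqrt 2"] by simp
        also have "(\<delta> - x * sqrt w) / sqrt 2 - (\<delta> - x * sqrt 1) / sqrt 2 = - (x * (sqrt w - 1) / sqrt 2)"
          by (simp add: field_simps)
        also have "\<bar>- (x * (sqrt w - 1) / sqrt 2)\<bar> = x * \<bar>sqrt w - 1\<bar> / sqrt 2"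
          using x by (simp add: abs_mult)
        also have "\<dots> \<le> x * 1 / 1"
          using x w 3 by (intro frac_le mult_left_mono) auto
        finally show ?thesis by simp
      qed
      have rest: "\<bar>\<Sum>m<M. mixed_cdf_deriv x \<delta> (Suc m) 1 / fact (Suc m) * (w - 1) ^ Suc m\<bar> \<le> (\<Sum>m<M. C m * x)"
      proof (rule order_trans[OF sum_abs sum_mono])
        fix m
        have "\<bar>w - 1\<bar> ^ Suc m \<le> 1"
          using w 3 by (intro power_le_one) auto
        moreover have "\<bar>mixed_cdf_deriv x \<delta> (Suc m) 1\<bar> / fact (Suc m) \<le> C m * x / 1"
          by (intro frac_le fact_ge_1 C x \<delta>) (use C0 x in auto)
        ultimately have "\<bar>mixed_cdf_deriv x \<delta> (Suc m) 1\<bar> / fact (Suc m) * \<bar>w - 1\<bar> ^ Suc m \<le> C m * x / 1 * 1"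
          using C0 x by (intro mult_mono) auto
        then show "\<bar>mixed_cdf_deriv x \<delta> (Suc m) 1 / fact (Suc m) * (w - 1) ^ Suc m\<bar> \<le> C m * x"
          by (simp add: abs_mult abs_divide power_abs del: power_Suc mixed_cdf_deriv.simps fact_Suc)
      qed
      have "1 \<le> (2 * (1 - w)) ^ Suc M"
        using 3 by (intro one_le_power) auto
      also have "\<dots> = 2 ^ Suc M * (w - 1) ^ Suc M"
        using M(2) by (simp only: power_mult_distrib power2_commute minus_diff_eq[of w 1, symmetric] power_minus_even)
      finally have pow: "1 \<le> 2 ^ Suc M * (w - 1) ^ Suc M" .
      have "\<bar>mixed_cdf x \<delta> w - (\<Sum>m<Suc M. mixed_cdf_deriv x \<delta> m 1 / fact m * (w - 1) ^ m)\<bar> =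
          \<bar>(mixed_cdf x \<delta> w - mixed_cdf x \<delta> 1) - (\<Sum>m<M. mixed_cdf_deriv x \<delta> (Suc m) 1 / fact (Suc m) * (w - 1) ^ Suc m)\<bar>"
        by (simp add: sum.lessThan_Suc_shift del: sum.lessThan_Suc power_Suc mixed_cdf_deriv.simps(2) fact_Suc)
      also have "\<dots> \<le> S * x"
        using first rest by (simp add: S_def algebra_simps sum_distrib_left)
      also have "\<dots> \<le> S * x * (2 ^ Suc M * (w - 1) ^ Suc M)"
        using pow S x mult_left_mono[OF pow, of "S * x"] by simp
      also have "\<dots> \<le> (C M + S * 2 ^ Suc M) * x * (w - 1) ^ Suc M"
      proof -
        have "0 \<le> C M * x * (w - 1) ^ Suc M"
          using C0 x M(2) by (intro mult_nonneg_nonneg zero_le_even_power) auto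
        then show ?thesis by (simp add: algebra_simps)
      qed
      finally show ?thesis .
    qed
  qed
  moreover have "C M + S * 2 ^ Suc M \<ge> 0" using C0 S by simp
  ultimately show ?thesis
    unfolding M(1) by blast
qed

section \<open>Truncation of polynomials in 1 / n and decay of the central moments\<close>

lemma poly_truncation_bound:
  fixes p :: "real poly" and h :: real
  assumes "coeff p 0 = 0" "0 \<le> h" "h \<le> 1"
  shows "\<bar>poly p h - (\<Sum>j=1..N. coeff p j * h ^ j)\<bar> \<le> (\<Sum>j\<le>degree p. \<bar>coeff p j\<bar>) * h ^ (N + 1)"
proof -
  \<comment> \<open>Padding with zero coefficients allows N to exceed the degree.\<close>
  have "poly p h = (\<Sum>j\<le>max N (degree p). coeff p j * h ^ j)"
    unfolding poly_altdef by (rule sum.mono_neutral_left) (auto simp: coeff_eq_0)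
  also have "{..max N (degree p)} = {0} \<union> {1..N} \<union> {N<..max N (degree p)}"
    by auto
  also have "(\<Sum>j\<in>{0} \<union> {1..N} \<union> {N<..max N (degree p)}. coeff p j * h ^ j) =
      (\<Sum>j=1..N. coeff p j * h ^ j) + (\<Sum>j\<in>{N<..max N (degree p)}. coeff p j * h ^ j)"
    using assms(1) by (subst sum.union_disjoint; auto)+
  finally have "poly p h - (\<Sum>j=1..N. coeff p j * h ^ j) = (\<Sum>j\<in>{N<..max N (degree p)}. coeff p j * h ^ j)"
    by simp
  also have "\<bar>\<dots>\<bar> \<le> (\<Sum>j\<in>{N<..max N (degree p)}. \<bar>coeff p j\<bar> * h ^ (N + 1))"
  proof (rule order_trans[OF sum_abs sum_mono])
    fix j assume "j \<in> {N<..max N (degree p)}"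
    then have "h ^ j \<le> h ^ (N + 1)"
      using assms by (intro power_decreasing) auto
    then show "\<bar>coeff p j * h ^ j\<bar> \<le> \<bar>coeff p j\<bar> * h ^ (N + 1)"
      using assms by (simp add: abs_mult mult_left_mono)
  qed
  also have "\<dots> \<le> (\<Sum>j\<le>degree p. \<bar>coeff p j\<bar> * h ^ (N + 1))"
    using assms by (intro sum_mono2) auto
  finally show ?thesis by (simp add: sum_distrib_right)
qed

text \<open>The coefficients at 1, ..., N vanish because 2 j < 2 N + 2, so the truncation error is
  the whole moment.\<close>

lemma central_moment_bounded:
  obtains K where "K \<ge> 0"
    "\<And>n. n \<ge> 1 \<Longrightarrow> \<bar>poly (central_moment_poly (2 * N + 2)) (1 / n)\<bar> \<le> K * (1 / n) ^ (N + 1)"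
proof
  let ?p = "central_moment_poly (2 * N + 2)"
  show "(\<Sum>j\<le>degree ?p. \<bar>coeff ?p j\<bar>) \<ge> 0"
    by (intro sum_nonneg) auto
  have "(\<Sum>j=1..N. coeff ?p j * h ^ j) = 0" for h :: real
    by (intro sum.neutral) (auto simp: coeff_central_moment_poly_eq_0 simp del: central_moment_poly.simps)
  then show "\<bar>poly ?p (1 / n)\<bar> \<le> (\<Sum>j\<le>degree ?p. \<bar>coeff ?p j\<bar>) * (1 / n) ^ (N + 1)" if "n \<ge> 1" for n
    using poly_truncation_bound[of ?p "1 / n" N] that
    by (simp add: coeff_central_moment_poly_eq_0 del: central_moment_poly.simps)
qed

section \<open>Asymptotic expansion\<close>

text \<open>The coefficient of n^(-j) in the Taylor sum with moments inserted, after division by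
  \<open>nct_B\<close>. Order m = 0 is the leading erfc term; orders above 2 j have no n^(-j) part,
  which makes the coefficient independent of N.\<close>

definition nct_coeff :: "nat \<Rightarrow> real \<Rightarrow> real \<Rightarrow> real" where
  "nct_coeff j x \<delta> =
     (\<Sum>m=1..2 * j. poly (deriv_poly x \<delta> (m - 1)) 1 / (2 * fact m) * coeff (central_moment_poly m) j)"

lemma nct_coeff_1: "nct_coeff 1 x \<delta> = 1/8 * (x * \<delta> - x^2 - 1)"
proof -
  have "{1..2 * 1} = {1, 2::nat}" by auto
  then show ?thesis
    by (simp add: nct_coeff_def numeral_2_eq_2 pderiv_pCons field_simps)
qed

lemma nct_coeff_2: "nct_coeff 2 x \<delta> = 1/192 *
       (3 * \<delta>^3 * x^3 - 9 * \<delta>^2 * x^4 + 9 * \<delta> * x^5 - 3 * x^6 - 2 * \<delta>^2 * x^2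
        - 5 * \<delta> * x^3 + 7 * x^4 - 3 * \<delta> * x + 5 * x^2 + 3)"
proof -
  have "{1..2 * 2} = {1, Suc 1, Suc (Suc 1), Suc (Suc (Suc 1))}" by auto
  \<comment> \<open>Orders 1 and 2 have no n^(-2) part; orders 3 and 4 have 8 and 12, and 8 / (2 *
    3!) = 2/3, 12 / (2 * 4!) = 1/4.\<close>
  then have "nct_coeff 2 x \<delta> = poly (deriv_poly x \<delta> (Suc (Suc 0))) 1 * (2/3) + poly (deriv_poly x \<delta> (Suc (Suc (Suc 0)))) 1 * (1/4)"
    by (simp add: nct_coeff_def fact_numeral del: deriv_poly.simps) (simp add: numeral_2_eq_2 coeff_pCons del: deriv_poly.simps)
  also have "\<dots> = 1/192 *
       (3 * \<delta>^3 * x^3 - 9 * \<delta>^2 * x^4 + 9 * \<delta> * x^5 - 3 * x^6 - 2 * \<delta>^2 * x^2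
        - 5 * \<delta> * x^3 + 7 * x^4 - 3 * \<delta> * x + 5 * x^2 + 3)"
    by (simp add: pderiv_mult pderiv_diff pderiv_pCons pderiv_add pderiv_smult) (simp add: field_simps power_numeral_reduce)
  finally show ?thesis .
qed

text \<open>The pointwise Taylor bound is integrated against the density. Since the power of w - 1
  in it is even, the bound integrates to a central moment and no absolute moments are
  needed.\<close>

lemma nct_F_moment_expansion:
  obtains C where "C \<ge> 0"
    "\<And>n x \<delta>. n > 0 \<Longrightarrow> 0 \<le> x \<Longrightarrow> x \<le> X \<Longrightarrow> \<bar>\<delta>\<bar> \<le> D \<Longrightarrow>
       \<bar>nct_F n x \<delta> - (\<Sum>m<2 * N + 2. mixed_cdf_deriv x \<delta> m 1 / fact m * poly (central_moment_poly m) (1 / n))\<bar>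
         \<le> C * x * poly (central_moment_poly (2 * N + 2)) (1 / n)"
proof -
  obtain C where C0: "C \<ge> 0" and C: "0 \<le> x \<Longrightarrow> x \<le> X \<Longrightarrow> \<bar>\<delta>\<bar> \<le> D \<Longrightarrow> w > 0 \<Longrightarrow>
     \<bar>mixed_cdf x \<delta> w - (\<Sum>m<2 * N + 2. mixed_cdf_deriv x \<delta> m 1 / fact m * (w - 1) ^ m)\<bar>
       \<le> C * x * (w - 1) ^ (2 * N + 2)" for x \<delta> w
    using mixed_cdf_taylor[of X D N] by blast
  have "\<bar>nct_F n x \<delta> - (\<Sum>m<2 * N + 2. mixed_cdf_deriv x \<delta> m 1 / fact m * poly (central_moment_poly m) (1 / n))\<bar>
         \<le> C * x * poly (central_moment_poly (2 * N + 2)) (1 / n)"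
    if n: "n > 0" and x: "0 \<le> x" "x \<le> X" and \<delta>: "\<bar>\<delta>\<bar> \<le> D" for n x \<delta>
  proof -
    let ?\<rho> = "gamma_density (n / 2)"
    let ?T = "\<lambda>w. \<Sum>m<2 * N + 2. mixed_cdf_deriv x \<delta> m 1 / fact m * (w - 1) ^ m"
    have mom: "has_bochner_integral lborel (\<lambda>w. ?\<rho> w * (w - 1) ^ m) (poly (central_moment_poly m) (1 / n))" for m
    proof -
      have "integrable lborel (\<lambda>w. ?\<rho> w * poly ([:-1, 1:] ^ m) w)"
        using n by (intro integrable_gamma_density_poly) auto
      then have "integrable lborel (\<lambda>w. ?\<rho> w * (w - 1) ^ m)"
        by (simp add: algebra_simps)
      then show ?thesis
        unfolding central_moment_eq[OF n, symmetric] by (rule has_bochner_integral_integrable)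
    qed
    have "has_bochner_integral lborel (\<lambda>w. \<Sum>m<2 * N + 2. mixed_cdf_deriv x \<delta> m 1 / fact m * (?\<rho> w * (w - 1) ^ m))
        (\<Sum>m<2 * N + 2. mixed_cdf_deriv x \<delta> m 1 / fact m * poly (central_moment_poly m) (1 / n))"
      by (intro has_bochner_integral_sum has_bochner_integral_mult_right mom)
    also have "(\<lambda>w. \<Sum>m<2 * N + 2. mixed_cdf_deriv x \<delta> m 1 / fact m * (?\<rho> w * (w - 1) ^ m)) = (\<lambda>w. ?\<rho> w * ?T w)"
      by (simp only: sum_distrib_left mult_ac)
    finally have "has_bochner_integral lborel (\<lambda>w. ?\<rho> w * mixed_cdf x \<delta> w - ?\<rho> w * ?T w)
        (nct_F n x \<delta> - (\<Sum>m<2 * N + 2. mixed_cdf_deriv x \<delta> m 1 / fact m * poly (central_moment_poly m) (1 / n)))"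
      by (intro has_bochner_integral_diff has_bochner_integral_nct_F n x)
    then have diff: "has_bochner_integral lborel (\<lambda>w. ?\<rho> w * (mixed_cdf x \<delta> w - ?T w))
        (nct_F n x \<delta> - (\<Sum>m<2 * N + 2. mixed_cdf_deriv x \<delta> m 1 / fact m * poly (central_moment_poly m) (1 / n)))"
      by (simp only: right_diff_distrib)
    have maj: "has_bochner_integral lborel (\<lambda>w. C * x * (?\<rho> w * (w - 1) ^ (2 * N + 2)))
        (C * x * poly (central_moment_poly (2 * N + 2)) (1 / n))"
      by (intro has_bochner_integral_mult_right mom)
    have "norm (?\<rho> w * (mixed_cdf x \<delta> w - ?T w)) \<le> C * x * (?\<rho> w * (w - 1) ^ (2 * N + 2))" for w
    proof (cases "w > 0")
      case True
      have "?\<rho> w * \<bar>mixed_cdf x \<delta> w - ?T w\<bar> \<le> ?\<rho> w * (C * x * (w - 1) ^ (2 * N + 2))"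
        using n by (intro mult_left_mono C x \<delta> True gamma_density_nonneg) auto
      moreover have "norm (?\<rho> w * (mixed_cdf x \<delta> w - ?T w)) = ?\<rho> w * \<bar>mixed_cdf x \<delta> w - ?T w\<bar>"
        using gamma_density_nonneg[of "n / 2" w] n by (simp only: real_norm_def abs_mult) simp
      ultimately show ?thesis
        by (simp only: mult_ac)
    qed (simp add: gamma_density_eq_0)
    then have "norm (\<integral>w. ?\<rho> w * (mixed_cdf x \<delta> w - ?T w) \<partial>lborel) \<le> (\<integral>w. C * x * (?\<rho> w * (w - 1) ^ (2 * N + 2)) \<partial>lborel)"
      by (intro Bochner_Integration.integral_norm_bound_integral integrable.intros[OF diff] integrable.intros[OF maj])
    then show ?thesis
      unfolding has_bochner_integral_integral_eq[OF diff] has_bochner_integral_integral_eq[OF maj] real_norm_def .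
  qed
  with C0 show thesis by (rule that)
qed

text \<open>\<open>nct_B\<close> is 2 x times the standard normal density at \<delta> - x, whence
  the division by 2.\<close>

lemma mixed_cdf_deriv_at_1:
  "mixed_cdf_deriv x \<delta> (Suc m) 1 = nct_B x \<delta> * (poly (deriv_poly x \<delta> m) 1 / 2)"
proof -
  have "sqrt (2 / pi) / 2 = 1 / sqrt (2 * pi)"
    by (simp add: real_sqrt_mult real_sqrt_divide field_simps)
  then have "nct_B x \<delta> / 2 = x * (exp (- (\<delta> - x)\<^sup>2 / 2) / sqrt (2 * pi))"
    by (simp add: nct_B_def field_simps)
  then show ?thesis by (simp only: mixed_cdf_deriv.simps) simp
qed

text \<open>Extending the sum to the N-dependent order 2 N + 1 adds only zeros, so the coefficients
  extracted for different N agree.\<close>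

lemma nct_coeff_truncation:
  assumes j: "j \<le> N"
  shows "(\<Sum>m=1..2 * N + 1. poly (deriv_poly x \<delta> (m - 1)) 1 / (2 * fact m) * coeff (central_moment_poly m) j)
     = nct_coeff j x \<delta>"
  unfolding nct_coeff_def
  by (rule sum.mono_neutral_right) (use j in \<open>auto simp: coeff_central_moment_poly_eq_0\<close>)

text \<open>Each moment is cut after n^(-N); exchanging the two sums collects the kept powers into
  \<open>nct_coeff\<close>, and the dropped ones are small because 1 / n \<le> 1.\<close>

lemma nct_coeff_expansion_bound:
  obtains K where "\<And>n x \<delta>. n \<ge> 1 \<Longrightarrow> \<bar>x\<bar> \<le> X \<Longrightarrow> \<bar>\<delta>\<bar> \<le> D \<Longrightarrow>
     \<bar>(\<Sum>m=1..2 * N + 1. poly (deriv_poly x \<delta> (m - 1)) 1 / (2 * fact m) * poly (central_moment_poly m) (1 / n))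
        - (\<Sum>k=1..N. nct_coeff k x \<delta> / n ^ k)\<bar> \<le> K * (1 / n) ^ (N + 1)"
proof -
  have "\<forall>k. \<exists>C\<ge>0. \<forall>x \<delta> t. \<bar>x\<bar> \<le> X \<longrightarrow> \<bar>\<delta>\<bar> \<le> D \<longrightarrow> \<bar>t\<bar> \<le> 2 \<longrightarrow> \<bar>poly (deriv_poly x \<delta> k) t\<bar> \<le> C"
    using poly_deriv_poly_bounded by blast
  then obtain C where C0: "C k \<ge> 0"
    and C: "\<bar>x\<bar> \<le> X \<Longrightarrow> \<bar>\<delta>\<bar> \<le> D \<Longrightarrow> \<bar>t\<bar> \<le> 2 \<Longrightarrow> \<bar>poly (deriv_poly x \<delta> k) t\<bar> \<le> C k" for k x \<delta> t
    by metis
  define s where "s m = (\<Sum>j\<le>degree (central_moment_poly m). \<bar>coeff (central_moment_poly m) j\<bar>)" for m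
  have s0: "s m \<ge> 0" for m by (simp add: s_def sum_nonneg)
  show thesis
  proof (rule that[of "\<Sum>m=1..2 * N + 1. C (m - 1) * s m"])
    fix n x \<delta> :: real
    assume n: "n \<ge> 1" and x: "\<bar>x\<bar> \<le> X" and \<delta>: "\<bar>\<delta>\<bar> \<le> D"
    let ?h = "1 / n"
    let ?a = "\<lambda>m. poly (deriv_poly x \<delta> (m - 1)) 1 / (2 * fact m)"
    let ?M = "central_moment_poly"
    have "(\<Sum>k=1..N. nct_coeff k x \<delta> / n ^ k) =
        (\<Sum>k=1..N. \<Sum>m=1..2 * N + 1. ?a m * (coeff (?M m) k * ?h ^ k))"
    proof (rule sum.cong[OF refl])
      fix k assume "k \<in> {1..N}"
      then have "nct_coeff k x \<delta> / n ^ k = (\<Sum>m=1..2 * N + 1. ?a m * coeff (?M m) k) * ?h ^ k"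
        by (subst nct_coeff_truncation) (auto simp: power_one_over)
      then show "nct_coeff k x \<delta> / n ^ k = (\<Sum>m=1..2 * N + 1. ?a m * (coeff (?M m) k * ?h ^ k))"
        by (simp only: sum_distrib_right mult.assoc)
    qed
    also have "\<dots> = (\<Sum>m=1..2 * N + 1. ?a m * (\<Sum>k=1..N. coeff (?M m) k * ?h ^ k))"
      by (subst sum.swap) (simp only: sum_distrib_left)
    finally have "\<bar>(\<Sum>m=1..2 * N + 1. ?a m * poly (?M m) ?h) - (\<Sum>k=1..N. nct_coeff k x \<delta> / n ^ k)\<bar>
        = \<bar>\<Sum>m=1..2 * N + 1. ?a m * (poly (?M m) ?h - (\<Sum>k=1..N. coeff (?M m) k * ?h ^ k))\<bar>"
      by (simp only: right_diff_distrib sum_subtractf)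
    also have "\<dots> \<le> (\<Sum>m=1..2 * N + 1. C (m - 1) * (s m * ?h ^ (N + 1)))"
    proof (rule order_trans[OF sum_abs sum_mono])
      fix m assume "m \<in> {1..2 * N + 1}"
      then have c0: "coeff (?M m) 0 = 0"
        by (intro coeff_central_moment_poly_eq_0) auto
      have "\<bar>?a m\<bar> \<le> C (m - 1) / 1"
      proof -
        have "2 * fact m \<ge> (1::real)" using fact_ge_1[of m, where 'a = real] by linarith
        then show ?thesis
          unfolding abs_divide by (intro frac_le C x \<delta> C0) auto
      qed
      moreover have "\<bar>poly (?M m) ?h - (\<Sum>k=1..N. coeff (?M m) k * ?h ^ k)\<bar> \<le> s m * ?h ^ (N + 1)"
        unfolding s_def using n by (intro poly_truncation_bound c0) auto
      ultimately show "\<bar>?a m * (poly (?M m) ?h - (\<Sum>k=1..N. coeff (?M m) k * ?h ^ k))\<bar> \<le> C (m - 1) * (s m * ?h ^ (N + 1))"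
        unfolding abs_mult using C0 by (intro mult_mono) auto
    qed
    finally show "\<bar>(\<Sum>m=1..2 * N + 1. ?a m * poly (?M m) ?h) - (\<Sum>k=1..N. nct_coeff k x \<delta> / n ^ k)\<bar>
        \<le> (\<Sum>m=1..2 * N + 1. C (m - 1) * s m) * ?h ^ (N + 1)"
      by (simp only: sum_distrib_right mult.assoc)
  qed
qed

text \<open>On bounded sets the Gaussian factor stays away from 0, so a remainder with a factor x
  can be divided by \<open>nct_B\<close> uniformly, even as x tends to 0.\<close>

lemma nct_B_lower_bound:
  assumes "0 \<le> x" "x \<le> X" "\<bar>\<delta>\<bar> \<le> D"
  shows "x * (sqrt (2 / pi) * exp (- (X + D)\<^sup>2 / 2)) \<le> nct_B x \<delta>"
proof -
  have "(\<delta> - x)\<^sup>2 \<le> (X + D)\<^sup>2"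
    using assms by (intro abs_le_square_iff[THEN iffD1]) linarith
  then show ?thesis
    using assms unfolding nct_B_def mult.assoc by (intro mult_left_mono) auto
qed

lemma nct_F_asymptotic_expansion:
  fixes X D :: real
  shows "\<exists>C. \<forall>n\<ge>1. \<forall>x \<delta>. 0 \<le> x \<longrightarrow> x \<le> X \<longrightarrow> \<bar>\<delta>\<bar> \<le> D \<longrightarrow>
    (\<exists>r. \<bar>r\<bar> \<le> C / n ^ (N + 1) \<and>
      nct_F n x \<delta> = 1/2 * erfc ((\<delta> - x) / sqrt 2)
        + nct_B x \<delta> * ((\<Sum>k=1..N. nct_coeff k x \<delta> / n ^ k) + r))"
proof -
  obtain C where C0: "C \<ge> 0" and C:
    "\<And>n x \<delta>. n > 0 \<Longrightarrow> 0 \<le> x \<Longrightarrow> x \<le> X \<Longrightarrow> \<bar>\<delta>\<bar> \<le> D \<Longrightarrow>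
       \<bar>nct_F n x \<delta> - (\<Sum>m<2 * N + 2. mixed_cdf_deriv x \<delta> m 1 / fact m * poly (central_moment_poly m) (1 / n))\<bar>
         \<le> C * x * poly (central_moment_poly (2 * N + 2)) (1 / n)"
    using nct_F_moment_expansion[of X D N] by blast
  obtain K where K0: "K \<ge> 0" and K:
    "\<And>n. n \<ge> 1 \<Longrightarrow> \<bar>poly (central_moment_poly (2 * N + 2)) (1 / n)\<bar> \<le> K * (1 / n) ^ (N + 1)"
    using central_moment_bounded[of N] by blast
  obtain L where L: "\<And>n x \<delta>. n \<ge> 1 \<Longrightarrow> \<bar>x\<bar> \<le> X \<Longrightarrow> \<bar>\<delta>\<bar> \<le> D \<Longrightarrow>
     \<bar>(\<Sum>m=1..2 * N + 1. poly (deriv_poly x \<delta> (m - 1)) 1 / (2 * fact m) * poly (central_moment_poly m) (1 / n))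
        - (\<Sum>k=1..N. nct_coeff k x \<delta> / n ^ k)\<bar> \<le> L * (1 / n) ^ (N + 1)"
    using nct_coeff_expansion_bound[of X D N] by blast
  define b where "b = sqrt (2 / pi) * exp (- (X + D)\<^sup>2 / 2)"
  have b: "b > 0" by (simp add: b_def)
  show ?thesis
  \<comment> \<open>L pays for the powers of 1 / n dropped from the moments, C K / b for the Taylor
    remainder: it is at most C K x n^(-N-1), and B \<ge> x b.\<close>
  proof (rule exI[of _ "L + C * K / b"], intro allI impI)
    fix n x \<delta> :: real
    assume n: "n \<ge> 1" and x: "0 \<le> x" "x \<le> X" and \<delta>: "\<bar>\<delta>\<bar> \<le> D"
    let ?B = "nct_B x \<delta>"
    let ?c = "\<Sum>k=1..N. nct_coeff k x \<delta> / n ^ k"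
    let ?p = "\<lambda>m. poly (central_moment_poly m) (1 / n)"
    define A where "A = (\<Sum>m=1..2 * N + 1. poly (deriv_poly x \<delta> (m - 1)) 1 / (2 * fact m) * ?p m)"
    define R where "R = nct_F n x \<delta> - (\<Sum>m<2 * N + 2. mixed_cdf_deriv x \<delta> m 1 / fact m * ?p m)"
    have A_bound: "\<bar>A - ?c\<bar> \<le> L * (1 / n) ^ (N + 1)"
      unfolding A_def using n x \<delta> by (intro L) auto
    have "{..<2 * N + 2} = insert 0 {1..2 * N + 1}" by auto
    then have "(\<Sum>m<2 * N + 2. mixed_cdf_deriv x \<delta> m 1 / fact m * ?p m) =
        mixed_cdf x \<delta> 1 + (\<Sum>m=1..2 * N + 1. mixed_cdf_deriv x \<delta> m 1 / fact m * ?p m)"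
      by simp
    also have "(\<Sum>m=1..2 * N + 1. mixed_cdf_deriv x \<delta> m 1 / fact m * ?p m) = ?B * A"
      unfolding A_def sum_distrib_left
    proof (rule sum.cong[OF refl])
      fix m assume "m \<in> {1..2 * N + 1}"
      then obtain l where l: "m = Suc l" by (cases m) auto
      show "mixed_cdf_deriv x \<delta> m 1 / fact m * ?p m = ?B * (poly (deriv_poly x \<delta> (m - 1)) 1 / (2 * fact m) * ?p m)"
        unfolding l mixed_cdf_deriv_at_1 by (simp del: fact_Suc)
    qed
    finally have F: "nct_F n x \<delta> = mixed_cdf x \<delta> 1 + ?B * A + R"
      by (simp add: R_def)
    have "\<bar>R\<bar> \<le> C * x * ?p (2 * N + 2)"
      unfolding R_def using n x \<delta> by (intro C) auto
    also have "\<dots> \<le> C * x * (K * (1 / n) ^ (N + 1))"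
      using C0 x by (intro mult_left_mono order_trans[OF abs_ge_self K[OF n]]) auto
    finally have R: "\<bar>R\<bar> \<le> x * (C * (K * (1 / n) ^ (N + 1)))"
      by (simp only: mult_ac)
    have Bb: "x * b \<le> ?B"
      unfolding b_def by (rule nct_B_lower_bound[OF x \<delta>])
    have RB: "\<bar>R / ?B\<bar> \<le> C * K / b * (1 / n) ^ (N + 1)" and RB': "?B * (R / ?B) = R"
    proof -
      show "\<bar>R / ?B\<bar> \<le> C * K / b * (1 / n) ^ (N + 1)"
      proof (cases "x = 0")
        case True
        then show ?thesis using R C0 K0 b n by simp
      next
        case False
        with x have x0: "x > 0" by simp
        then have "x * b > 0" using b by simp
        then have "\<bar>R / ?B\<bar> \<le> x * (C * (K * (1 / n) ^ (N + 1))) / (x * b)"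
          unfolding abs_divide using R Bb by (intro frac_le) auto
        then show ?thesis using x0 by (simp add: mult_ac)
      qed
      \<comment> \<open>If x = 0, then \<open>?B\<close> is 0 and the bound on R forces R = 0, so
        the identity survives the convention R / 0 = 0.\<close>
      show "?B * (R / ?B) = R"
        using R x b by (auto simp: nct_B_def)
    qed
    show "\<exists>r. \<bar>r\<bar> \<le> (L + C * K / b) / n ^ (N + 1) \<and>
      nct_F n x \<delta> = 1/2 * erfc ((\<delta> - x) / sqrt 2) + ?B * (?c + r)"
    proof (intro exI conjI)
      have "\<bar>(A - ?c) + R / ?B\<bar> \<le> L * (1 / n) ^ (N + 1) + C * K / b * (1 / n) ^ (N + 1)"
        using A_bound RB by linarith
      also have "\<dots> = (L + C * K / b) / n ^ (N + 1)"
        by (simp only: power_one_over distrib_right[symmetric]) simp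
      finally show "\<bar>(A - ?c) + R / ?B\<bar> \<le> (L + C * K / b) / n ^ (N + 1)" .
      have "?B * (?c + (A - ?c + R / ?B)) = ?B * A + ?B * (R / ?B)"
        by (simp only: distrib_left[symmetric]) simp
      then show "nct_F n x \<delta> = 1/2 * erfc ((\<delta> - x) / sqrt 2) + ?B * (?c + (A - ?c + R / ?B))"
        unfolding RB' F by (simp add: mixed_cdf_def)
    qed
  qed
qed

theorem theorem6p1:
  shows "\<exists>c :: nat \<Rightarrow> real \<Rightarrow> real \<Rightarrow> real.
    (\<forall>x\<ge>0. \<forall>\<delta>. c 1 x \<delta> = 1/8 * (x * \<delta> - x^2 - 1)) \<and>
    (\<forall>x\<ge>0. \<forall>\<delta>. c 2 x \<delta> = 1/192 *
       (3 * \<delta>^3 * x^3 - 9 * \<delta>^2 * x^4 + 9 * \<delta> * x^5 - 3 * x^6 - 2 * \<delta>^2 * x^2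
        - 5 * \<delta> * x^3 + 7 * x^4 - 3 * \<delta> * x + 5 * x^2 + 3)) \<and>
    (\<forall>N\<ge>1. \<forall>X D :: real set. bounded X \<and> X \<subseteq> {0..} \<and> bounded D \<longrightarrow>
       (\<exists>C n0 :: real. n0 > 0 \<and>
         (\<forall>n\<ge>n0. \<forall>x\<in>X. \<forall>\<delta>\<in>D. \<exists>r :: real.
            \<bar>r\<bar> \<le> C / n ^ (N + 1) \<and>
            nct_F n x \<delta> = 1/2 * erfc ((\<delta> - x) / sqrt 2)
              + nct_B x \<delta> * ((\<Sum>k=1..N. c k x \<delta> / n ^ k) + r))))"
proof (intro exI[of _ nct_coeff] conjI allI impI)
  fix N :: nat and X D :: "real set"
  assume "bounded X \<and> X \<subseteq> {0..} \<and> bounded D"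
  then obtain a d where a: "\<And>x. x \<in> X \<Longrightarrow> 0 \<le> x \<and> x \<le> a" and d: "\<And>\<delta>. \<delta> \<in> D \<Longrightarrow> \<bar>\<delta>\<bar> \<le> d"
    unfolding bounded_pos real_norm_def by (metis abs_le_D1 atLeast_iff subsetD)
  obtain C where "\<forall>n\<ge>1. \<forall>x \<delta>. 0 \<le> x \<longrightarrow> x \<le> a \<longrightarrow> \<bar>\<delta>\<bar> \<le> d \<longrightarrow>
    (\<exists>r. \<bar>r\<bar> \<le> C / n ^ (N + 1) \<and>
      nct_F n x \<delta> = 1/2 * erfc ((\<delta> - x) / sqrt 2)
        + nct_B x \<delta> * ((\<Sum>k=1..N. nct_coeff k x \<delta> / n ^ k) + r))"
    using nct_F_asymptotic_expansion by blast
  with a d show "\<exists>C n0 :: real. n0 > 0 \<and>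
         (\<forall>n\<ge>n0. \<forall>x\<in>X. \<forall>\<delta>\<in>D. \<exists>r :: real.
            \<bar>r\<bar> \<le> C / n ^ (N + 1) \<and>
            nct_F n x \<delta> = 1/2 * erfc ((\<delta> - x) / sqrt 2)
              + nct_B x \<delta> * ((\<Sum>k=1..N. nct_coeff k x \<delta> / n ^ k) + r))"
    by - (rule exI[of _ C], rule exI[of _ 1], rule conjI[OF zero_less_one], blast)
qed (rule nct_coeff_1 nct_coeff_2)+

end
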